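(* Let $(M,g)$ be a Riemannian manifold of dimension $n$, and let $\overline\nabla$ be the Levi-Civita connection of the pseudo-Riemannian metric $\tilde g_2$ (the $0$-homogeneous lift of $g$) on the slit tangent bundle $\widetilde{TM}$. Its coefficients in the adapted frame $\{X_i,X_{\bar i}\}$ are: (1) $\overline\Gamma_{ji}{}^h=\Gamma_{ji}{}^h$; (2) $\overline\Gamma_{ji}{}^{\bar h}=y^aK_{aij}{}^h$; (3) $\overline\Gamma_{\bar ji}{}^h=\frac{1}{2\|y\|^2}(g_{ij}y^h-\delta_i^hy_j)$; (4) $\overline\Gamma_{j\bar i}{}^h=\frac{1}{2\|y\|^2}(g_{ij}y^h-\delta_j^hy_i)$; (5) $\overline\Gamma_{\bar ji}{}^{\bar h}=\Gamma_{ji}{}^h$; (6) $\overline\Gamma_{j\bar i}{}^{\bar h}=0$; (7) $\overline\Gamma_{\bar j\bar i}{}^h=0$; (8) $\overline\Gamma_{\bar j\bar i}{}^{\bar h}=-\frac{1}{2\|y\|^2}(\delta_i^hy_j+\delta_j^hy_i)$.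
   Context: Let $(x^i)$ be local coordinates on $M$, $(x^i,y^i)$ the induced coordinates on $TM$, $\widetilde{TM}=TM\setminus\{0\}$ the tangent bundle minus its zero section, $g_{ij}$ the components of $g$, $\Gamma_{ij}{}^k$ the Christoffel symbols of its Levi-Civita connection $\nabla$; the summation convention is used. Put $\|y\|=\sqrt{g_{ij}(x)y^iy^j}$ and $y_i=g_{ij}y^j$. Define the local frame $X_i=\frac{\partial}{\partial x^i}-y^a\Gamma_{ai}{}^m\frac{\partial}{\partial y^m}$, $X_{\bar i}=\frac{\partial}{\partial y^i}$ of $T\widetilde{TM}$ (adapted frame), with dual coframe $dx^i$, $\delta y^i=dy^i+y^a\Gamma_{aj}{}^i dx^j$. The $0$-homogeneous lift of $g$ is $\tilde g_2=\frac{2}{\|y\|}g_{ij}(x)\,dx^i\,\delta y^j$, i.e. the symmetric tensor with $\tilde g_2(X_i,X_j)=0=\tilde g_2(X_{\bar i},X_{\bar j})$ and $\tilde g_2(X_i,X_{\bar j})=\tilde g_2(X_{\bar j},X_i)=\frac{2}{\|y\|}g_{ij}$. $K_{jia}{}^m$ are the components of the curvature tensor of $g$: $K_{jia}{}^m\partial_m=R(\partial_j,\partial_i)\partial_a$ with $R(X,Y)=\nabla_X\nabla_Y-\nabla_Y\nabla_X-\nabla_{[X,Y]}$; equivalently $[X_i,X_j]=y^aK_{jia}{}^mX_{\bar m}$. The coefficients are defined by $\overline\nabla_{X_i}X_j=\overline\Gamma_{ji}{}^mX_m+\overline\Gamma_{ji}{}^{\bar m}X_{\bar m}$, $\overline\nabla_{X_i}X_{\bar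 j}=\overline\Gamma_{\bar ji}{}^mX_m+\overline\Gamma_{\bar ji}{}^{\bar m}X_{\bar m}$, $\overline\nabla_{X_{\bar i}}X_j=\overline\Gamma_{j\bar i}{}^mX_m+\overline\Gamma_{j\bar i}{}^{\bar m}X_{\bar m}$, $\overline\nabla_{X_{\bar i}}X_{\bar j}=\overline\Gamma_{\bar j\bar i}{}^mX_m+\overline\Gamma_{\bar j\bar i}{}^{\bar m}X_{\bar m}$ (the second lower index is the differentiation direction). *)

theory Defs
  imports "HOL-Analysis.Analysis"
begin

section \<open>Smooth maps between Euclidean spaces\<close>

text \<open>Meant for open \<open>S\<close> only.\<close>

primrec Ck_on ::
  "nat \<Rightarrow> 'a::euclidean_space set \<Rightarrow> ('a \<Rightarrow> 'b::real_normed_vector) \<Rightarrow> bool" where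
  "Ck_on 0 S f \<longleftrightarrow> continuous_on S f"
| "Ck_on (Suc k) S f \<longleftrightarrow>
     f differentiable_on S \<and> (\<forall>v. Ck_on k S (\<lambda>x. frechet_derivative f (at x) v))"

definition smooth_on :: "'a::euclidean_space set \<Rightarrow> ('a \<Rightarrow> 'b::real_normed_vector) \<Rightarrow> bool" where
  "smooth_on S f \<longleftrightarrow> (\<forall>k. Ck_on k S f)"


section \<open>Smooth manifolds\<close>

text \<open>
  A chart is a pair of its domain and its coordinate map; the values of the coordinate map outside
  the domain are irrelevant.  The point set and the topology of a manifold are determined by its
  atlas.
\<close>

type_synonym ('p, 'e) chart = "'p set \<times> ('p \<Rightarrow> 'e)"

definition inv_chart :: "('p, 'e) chart \<Rightarrow> 'e \<Rightarrow> 'p" where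
  "inv_chart c = inv_into (fst c) (snd c)"

definition is_chart :: "('p, 'e::euclidean_space) chart \<Rightarrow> bool" where
  "is_chart c \<longleftrightarrow> inj_on (snd c) (fst c) \<and> open (snd c ` fst c)"

definition compatible :: "('p, 'e::euclidean_space) chart \<Rightarrow> ('p, 'e) chart \<Rightarrow> bool" where
  "compatible c d \<longleftrightarrow>
     open (snd c ` (fst c \<inter> fst d)) \<and> open (snd d ` (fst c \<inter> fst d)) \<and>
     smooth_on (snd c ` (fst c \<inter> fst d)) (snd d \<circ> inv_chart c) \<and>
     smooth_on (snd d ` (fst c \<inter> fst d)) (snd c \<circ> inv_chart d)"

definition points :: "('p, 'e) chart set \<Rightarrow> 'p set" where
  "points A = \<Union> (fst ` A)"

definition smooth_atlas :: "('p, 'e::euclidean_space) chart set \<Rightarrow> bool" where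
  "smooth_atlas A \<longleftrightarrow> (\<forall>c\<in>A. is_chart c) \<and> (\<forall>c\<in>A. \<forall>d\<in>A. compatible c d)"

definition atlas_open :: "('p, 'e::euclidean_space) chart set \<Rightarrow> 'p set \<Rightarrow> bool" where
  "atlas_open A W \<longleftrightarrow> W \<subseteq> points A \<and> (\<forall>c\<in>A. open (snd c ` (fst c \<inter> W)))"

definition atlas_topology :: "('p, 'e::euclidean_space) chart set \<Rightarrow> 'p topology" where
  "atlas_topology A = topology (atlas_open A)"

lemma openin_atlas_topology:
  assumes "smooth_atlas A"
  shows "openin (atlas_topology A) W \<longleftrightarrow> atlas_open A W"
proof -
  have inj: "inj_on (snd c) (fst c)" if "c \<in> A" for c
    using assms that by (auto simp: smooth_atlas_def is_chart_def)
  have "istopology (atlas_open A)"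
    unfolding istopology_def
  proof (intro conjI allI impI)
    fix S T assume S: "atlas_open A S" and T: "atlas_open A T"
    have "open (snd c ` (fst c \<inter> (S \<inter> T)))" if c: "c \<in> A" for c
    proof -
      have "snd c ` (fst c \<inter> (S \<inter> T)) = snd c ` (fst c \<inter> S) \<inter> snd c ` (fst c \<inter> T)"
        using inj[OF c] by (fastforce simp: inj_on_def)
      then show ?thesis using S T c by (simp add: atlas_open_def open_Int)
    qed
    then show "atlas_open A (S \<inter> T)" using S by (auto simp: atlas_open_def)
  next
    fix \<K> assume K: "\<forall>K\<in>\<K>. atlas_open A K"
    have "open (snd c ` (fst c \<inter> \<Union>\<K>))" if c: "c \<in> A" for c
    proof -
      have "snd c ` (fst c \<inter> \<Union>\<K>) = (\<Union>K\<in>\<K>. snd c ` (fst c \<inter> K))" by blast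
      then show ?thesis using K c by (auto simp: atlas_open_def)
    qed
    then show "atlas_open A (\<Union>\<K>)" using K by (auto simp: atlas_open_def)
  qed
  then show ?thesis by (simp add: atlas_topology_def topology_inverse')
qed

text \<open>
  A smooth manifold is given by its maximal atlas, whose members are exactly the local coordinate
  systems of the manifold.
\<close>

definition smooth_manifold :: "('p, 'e::euclidean_space) chart set \<Rightarrow> bool" where
  "smooth_manifold A \<longleftrightarrow> smooth_atlas A \<and>
     (\<forall>d. is_chart d \<and> fst d \<subseteq> points A \<and> (\<forall>c\<in>A. compatible c d) \<longrightarrow> d \<in> A) \<and>
     Hausdorff_space (atlas_topology A) \<and> second_countable (atlas_topology A)"


section \<open>Smooth functions, tangent vectors and vector fields\<close>

text \<open>\<open>smooth_at A p f\<close>: the function \<open>f\<close> is smooth in a neighbourhood of \<open>p\<close>.\<close>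

definition smooth_at :: "('p, 'e::euclidean_space) chart set \<Rightarrow> 'p \<Rightarrow> ('p \<Rightarrow> real) \<Rightarrow> bool" where
  "smooth_at A p f \<longleftrightarrow>
     (\<exists>c\<in>A. p \<in> fst c \<and>
       (\<exists>S. open S \<and> snd c p \<in> S \<and> S \<subseteq> snd c ` fst c \<and> smooth_on S (f \<circ> inv_chart c)))"

definition smooth_fun :: "('p, 'e::euclidean_space) chart set \<Rightarrow> 'p set \<Rightarrow> ('p \<Rightarrow> real) \<Rightarrow> bool" where
  "smooth_fun A W f \<longleftrightarrow> (\<forall>p\<in>W. smooth_at A p f)"

text \<open>
  Tangent vectors at \<open>p\<close> are operators on functions smooth near \<open>p\<close>, extended by \<open>0\<close> to all other
  functions; thus equality of tangent vectors is equality of operators and the zero vector is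
  \<open>\<lambda>f. 0\<close>.  For the unit vectors \<open>e\<close>, the operators \<open>coord_vec A c p e\<close> are the partial
  derivatives at \<open>p\<close> in the coordinates \<open>c\<close>.
\<close>

type_synonym 'p tvec = "('p \<Rightarrow> real) \<Rightarrow> real"

type_synonym 'p vfield = "'p \<Rightarrow> 'p tvec"

definition coord_vec ::
  "('p, 'e::euclidean_space) chart set \<Rightarrow> ('p, 'e) chart \<Rightarrow> 'p \<Rightarrow> 'e \<Rightarrow> 'p tvec" where
  "coord_vec A c p e =
     (\<lambda>f. if smooth_at A p f then frechet_derivative (f \<circ> inv_chart c) (at (snd c p)) e else 0)"

definition tangent_space :: "('p, 'e::euclidean_space) chart set \<Rightarrow> 'p \<Rightarrow> 'p tvec set" where
  "tangent_space A p = {coord_vec A c p e | c e. c \<in> A \<and> p \<in> fst c}"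

text \<open>Smooth vector fields on an open set \<open>W\<close>; values outside \<open>W\<close> are irrelevant.\<close>

definition vector_fields :: "('p, 'e::euclidean_space) chart set \<Rightarrow> 'p set \<Rightarrow> 'p vfield set" where
  "vector_fields A W =
     {X. \<forall>p\<in>W. X p \<in> tangent_space A p \<and>
           (\<forall>f. smooth_at A p f \<longrightarrow> smooth_at A p (\<lambda>q. X q f))}"

definition lie_bracket ::
  "('p, 'e::euclidean_space) chart set \<Rightarrow> 'p vfield \<Rightarrow> 'p vfield \<Rightarrow> 'p vfield" where
  "lie_bracket A X Y =
     (\<lambda>p f. if smooth_at A p f then X p (\<lambda>q. Y q f) - Y p (\<lambda>q. X q f) else 0)"

text \<open>The components of a tangent vector \<open>v\<close> at \<open>p\<close> with respect to a local frame \<open>E\<close>.\<close>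

definition frame_comp :: "('i::finite \<Rightarrow> 'p vfield) \<Rightarrow> 'p \<Rightarrow> 'p tvec \<Rightarrow> 'i \<Rightarrow> real" where
  "frame_comp E p v = (THE a. v = (\<lambda>f. \<Sum>\<gamma>\<in>UNIV. a \<gamma> * E \<gamma> p f))"


section \<open>Metrics and connections\<close>

definition symmetric_bilinear_on :: "'p tvec set \<Rightarrow> ('p tvec \<Rightarrow> 'p tvec \<Rightarrow> real) \<Rightarrow> bool" where
  "symmetric_bilinear_on V b \<longleftrightarrow>
     (\<forall>u\<in>V. \<forall>v\<in>V. b u v = b v u) \<and>
     (\<forall>u\<in>V. \<forall>v\<in>V. \<forall>w\<in>V. \<forall>r s. b (\<lambda>f. r * u f + s * v f) w = r * b u w + s * b v w)"

definition riemannian_metric ::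
  "('p, 'e::euclidean_space) chart set \<Rightarrow> ('p \<Rightarrow> 'p tvec \<Rightarrow> 'p tvec \<Rightarrow> real) \<Rightarrow> bool" where
  "riemannian_metric A g \<longleftrightarrow>
     (\<forall>p\<in>points A. symmetric_bilinear_on (tangent_space A p) (g p) \<and>
        (\<forall>v\<in>tangent_space A p. v \<noteq> (\<lambda>f. 0) \<longrightarrow> g p v v > 0)) \<and>
     (\<forall>W. atlas_open A W \<longrightarrow>
        (\<forall>X\<in>vector_fields A W. \<forall>Y\<in>vector_fields A W. smooth_fun A W (\<lambda>p. g p (X p) (Y p))))"

text \<open>
  \<open>D X Y\<close> is the covariant derivative of \<open>Y\<close> along \<open>X\<close>.  A connection acts on the smooth vector
  fields on every open set, compatibly with restriction to smaller open sets (second clause), so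
  that it can be applied to local frames.
\<close>

definition connection ::
  "('p, 'e::euclidean_space) chart set \<Rightarrow> ('p vfield \<Rightarrow> 'p vfield \<Rightarrow> 'p vfield) \<Rightarrow> bool" where
  "connection A D \<longleftrightarrow> (\<forall>W. atlas_open A W \<longrightarrow>
     (\<forall>X\<in>vector_fields A W. \<forall>Y\<in>vector_fields A W. D X Y \<in> vector_fields A W) \<and>
     (\<forall>X\<in>vector_fields A W. \<forall>X'\<in>vector_fields A W.
      \<forall>Y\<in>vector_fields A W. \<forall>Y'\<in>vector_fields A W.
        (\<forall>p\<in>W. X p = X' p \<and> Y p = Y' p) \<longrightarrow> (\<forall>p\<in>W. D X Y p = D X' Y' p)) \<and>
     (\<forall>X\<in>vector_fields A W. \<forall>X'\<in>vector_fields A W. \<forall>Y\<in>vector_fields A W. \<forall>p\<in>W.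
        D (\<lambda>q f. X q f + X' q f) Y p = (\<lambda>f. D X Y p f + D X' Y p f)) \<and>
     (\<forall>X\<in>vector_fields A W. \<forall>Y\<in>vector_fields A W. \<forall>Y'\<in>vector_fields A W. \<forall>p\<in>W.
        D X (\<lambda>q f. Y q f + Y' q f) p = (\<lambda>f. D X Y p f + D X Y' p f)) \<and>
     (\<forall>h. smooth_fun A W h \<longrightarrow>
       (\<forall>X\<in>vector_fields A W. \<forall>Y\<in>vector_fields A W. \<forall>p\<in>W.
          D (\<lambda>q f. h q * X q f) Y p = (\<lambda>f. h p * D X Y p f) \<and>
          D X (\<lambda>q f. h q * Y q f) p = (\<lambda>f. X p h * Y p f + h p * D X Y p f))))"

definition torsion_free ::
  "('p, 'e::euclidean_space) chart set \<Rightarrow> ('p vfield \<Rightarrow> 'p vfield \<Rightarrow> 'p vfield) \<Rightarrow> bool" where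
  "torsion_free A D \<longleftrightarrow> (\<forall>W. atlas_open A W \<longrightarrow>
     (\<forall>X\<in>vector_fields A W. \<forall>Y\<in>vector_fields A W. \<forall>p\<in>W.
        (\<lambda>f. D X Y p f - D Y X p f) = lie_bracket A X Y p))"

definition metric_compatible ::
  "('p, 'e::euclidean_space) chart set \<Rightarrow> ('p \<Rightarrow> 'p tvec \<Rightarrow> 'p tvec \<Rightarrow> real) \<Rightarrow>
   ('p vfield \<Rightarrow> 'p vfield \<Rightarrow> 'p vfield) \<Rightarrow> bool" where
  "metric_compatible A g D \<longleftrightarrow> (\<forall>W. atlas_open A W \<longrightarrow>
     (\<forall>X\<in>vector_fields A W. \<forall>Y\<in>vector_fields A W. \<forall>Z\<in>vector_fields A W. \<forall>p\<in>W.
        X p (\<lambda>q. g q (Y q) (Z q)) = g p (D X Y p) (Z p) + g p (Y p) (D X Z p)))"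

definition levi_civita ::
  "('p, 'e::euclidean_space) chart set \<Rightarrow> ('p \<Rightarrow> 'p tvec \<Rightarrow> 'p tvec \<Rightarrow> real) \<Rightarrow>
   ('p vfield \<Rightarrow> 'p vfield \<Rightarrow> 'p vfield) \<Rightarrow> bool" where
  "levi_civita A g D \<longleftrightarrow> connection A D \<and> torsion_free A D \<and> metric_compatible A g D"

definition curvature ::
  "('p, 'e::euclidean_space) chart set \<Rightarrow> ('p vfield \<Rightarrow> 'p vfield \<Rightarrow> 'p vfield) \<Rightarrow>
   'p vfield \<Rightarrow> 'p vfield \<Rightarrow> 'p vfield \<Rightarrow> 'p vfield" where
  "curvature A D X Y Z =
     (\<lambda>p f. D X (D Y Z) p f - D Y (D X Z) p f - D (lie_bracket A X Y) Z p f)"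

text \<open>
  The coefficients \<open>\<Gamma> \<beta> \<alpha> \<gamma>\<close> of \<open>D\<close> in a frame \<open>E\<close>, given by
  \<open>D (E \<alpha>) (E \<beta>) = (\<Sum>\<gamma>. \<Gamma> \<beta> \<alpha> \<gamma> E \<gamma>)\<close>: the second index is the direction of differentiation.
\<close>

definition conn_coeff ::
  "('p vfield \<Rightarrow> 'p vfield \<Rightarrow> 'p vfield) \<Rightarrow> ('i::finite \<Rightarrow> 'p vfield) \<Rightarrow> 'p \<Rightarrow>
   'i \<Rightarrow> 'i \<Rightarrow> 'i \<Rightarrow> real" where
  "conn_coeff D E p \<beta> \<alpha> \<gamma> = frame_comp E p (D (E \<alpha>) (E \<beta>) p) \<gamma>"


section \<open>Components in local coordinates\<close>

definition coord_frame ::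
  "('p, real^'n) chart set \<Rightarrow> ('p, real^'n) chart \<Rightarrow> 'n::finite \<Rightarrow> 'p vfield" where
  "coord_frame A c i = (\<lambda>p. coord_vec A c p (axis i 1))"

definition metric_comp ::
  "('p, real^'n) chart set \<Rightarrow> ('p \<Rightarrow> 'p tvec \<Rightarrow> 'p tvec \<Rightarrow> real) \<Rightarrow> ('p, real^'n) chart \<Rightarrow> 'p \<Rightarrow>
   'n::finite \<Rightarrow> 'n \<Rightarrow> real" where
  "metric_comp A g c p i j = g p (coord_frame A c i p) (coord_frame A c j p)"

definition christoffel ::
  "('p, real^'n) chart set \<Rightarrow> ('p vfield \<Rightarrow> 'p vfield \<Rightarrow> 'p vfield) \<Rightarrow> ('p, real^'n) chart \<Rightarrow> 'p \<Rightarrow>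
   'n::finite \<Rightarrow> 'n \<Rightarrow> 'n \<Rightarrow> real" where
  "christoffel A D c p = conn_coeff D (coord_frame A c) p"

text \<open>\<open>curv_comp A D c p j i a m\<close> is the \<open>m\<close>-th component of \<open>R(\<partial>\<^sub>j, \<partial>\<^sub>i)\<partial>\<^sub>a\<close>.\<close>

definition curv_comp ::
  "('p, real^'n) chart set \<Rightarrow> ('p vfield \<Rightarrow> 'p vfield \<Rightarrow> 'p vfield) \<Rightarrow> ('p, real^'n) chart \<Rightarrow> 'p \<Rightarrow>
   'n::finite \<Rightarrow> 'n \<Rightarrow> 'n \<Rightarrow> 'n \<Rightarrow> real" where
  "curv_comp A D c p j i a m =
     frame_comp (coord_frame A c) p
       (curvature A D (coord_frame A c j) (coord_frame A c i) (coord_frame A c a) p) m"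


section \<open>The slit tangent bundle\<close>

text \<open>
  Points are pairs \<open>(p, v)\<close> of a point and a nonzero tangent vector at it.  The induced coordinates
  are \<open>(x\<^sup>i, y\<^sup>i)\<close> with \<open>y\<^sup>i = v(x\<^sup>i)\<close>.
\<close>

type_synonym 'p bpoint = "'p \<times> 'p tvec"

definition slit_dom :: "('p, real^'n::finite) chart set \<Rightarrow> ('p, real^'n) chart \<Rightarrow> 'p bpoint set" where
  "slit_dom A c = {(p, v). p \<in> fst c \<and> v \<in> tangent_space A p \<and> v \<noteq> (\<lambda>f. 0)}"

definition fibre_coord :: "('p, real^'n::finite) chart \<Rightarrow> 'p bpoint \<Rightarrow> 'n \<Rightarrow> real" where
  "fibre_coord c q i = snd q (\<lambda>r. snd c r $ i)"

definition slit_chart ::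
  "('p, real^'n::finite) chart set \<Rightarrow> ('p, real^'n) chart \<Rightarrow>
   ('p bpoint, (real^'n) \<times> (real^'n)) chart" where
  "slit_chart A c = (slit_dom A c, \<lambda>q. (snd c (fst q), \<chi> i. fibre_coord c q i))"

definition slit_atlas ::
  "('p, real^'n::finite) chart set \<Rightarrow> ('p bpoint, (real^'n) \<times> (real^'n)) chart set" where
  "slit_atlas A = slit_chart A ` A"

text \<open>
  The adapted frame; the index \<open>Inl i\<close> stands for \<open>i\<close> and \<open>Inr i\<close> for \<open>i\<close> with a bar.
\<close>

definition adapted_frame ::
  "('p, real^'n::finite) chart set \<Rightarrow> ('p vfield \<Rightarrow> 'p vfield \<Rightarrow> 'p vfield) \<Rightarrow>
   ('p, real^'n) chart \<Rightarrow> 'n + 'n \<Rightarrow> 'p bpoint vfield" where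
  "adapted_frame A D c \<alpha> = (\<lambda>q.
     let dx = (\<lambda>i. coord_vec (slit_atlas A) (slit_chart A c) q (axis i 1, 0));
         dy = (\<lambda>i. coord_vec (slit_atlas A) (slit_chart A c) q (0, axis i 1))
     in case \<alpha> of
       Inl i \<Rightarrow> (\<lambda>f. dx i f -
         (\<Sum>m\<in>UNIV. \<Sum>a\<in>UNIV. fibre_coord c q a * christoffel A D c (fst q) a i m * dy m f))
     | Inr i \<Rightarrow> dy i)"

definition fibre_norm ::
  "('p, real^'n::finite) chart set \<Rightarrow> ('p \<Rightarrow> 'p tvec \<Rightarrow> 'p tvec \<Rightarrow> real) \<Rightarrow> ('p, real^'n) chart \<Rightarrow>
   'p bpoint \<Rightarrow> real" where
  "fibre_norm A g c q =
     sqrt (\<Sum>i\<in>UNIV. \<Sum>j\<in>UNIV. metric_comp A g c (fst q) i j * fibre_coord c q i * fibre_coord c q j)"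

definition fibre_coord_low ::
  "('p, real^'n::finite) chart set \<Rightarrow> ('p \<Rightarrow> 'p tvec \<Rightarrow> 'p tvec \<Rightarrow> real) \<Rightarrow> ('p, real^'n) chart \<Rightarrow>
   'p bpoint \<Rightarrow> 'n \<Rightarrow> real" where
  "fibre_coord_low A g c q i = (\<Sum>j\<in>UNIV. metric_comp A g c (fst q) i j * fibre_coord c q j)"

text \<open>
  The \<open>0\<close>-homogeneous lift of \<open>g\<close>, where \<open>D\<close> is the Levi-Civita connection of \<open>g\<close>: the symmetric
  tensor given in each local coordinate system by its values on the adapted frame (these values
  transform consistently under a change of coordinates on the base).
\<close>

definition homogeneous_lift ::
  "('p, real^'n::finite) chart set \<Rightarrow> ('p \<Rightarrow> 'p tvec \<Rightarrow> 'p tvec \<Rightarrow> real) \<Rightarrow>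
   ('p vfield \<Rightarrow> 'p vfield \<Rightarrow> 'p vfield) \<Rightarrow>
   ('p bpoint \<Rightarrow> 'p bpoint tvec \<Rightarrow> 'p bpoint tvec \<Rightarrow> real) \<Rightarrow> bool" where
  "homogeneous_lift A g D G \<longleftrightarrow>
     (\<forall>q\<in>points (slit_atlas A). symmetric_bilinear_on (tangent_space (slit_atlas A) q) (G q)) \<and>
     (\<forall>c\<in>A. \<forall>q\<in>slit_dom A c. \<forall>i j.
        G q (adapted_frame A D c (Inl i) q) (adapted_frame A D c (Inl j) q) = 0 \<and>
        G q (adapted_frame A D c (Inr i) q) (adapted_frame A D c (Inr j) q) = 0 \<and>
        G q (adapted_frame A D c (Inl i) q) (adapted_frame A D c (Inr j) q) =
          2 / fibre_norm A g c q * metric_comp A g c (fst q) i j \<and>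
        G q (adapted_frame A D c (Inr j) q) (adapted_frame A D c (Inl i) q) =
          2 / fibre_norm A g c q * metric_comp A g c (fst q) i j)"

definition kron :: "'i \<Rightarrow> 'i \<Rightarrow> real" where
  "kron i j = (if i = j then 1 else 0)"

end

theory Submission
  imports Defs
begin

text \<open>
  The Koszul formula expresses \<open>2 G(Dbar E\<^sub>\<alpha> E\<^sub>\<beta>, E\<^sub>\<gamma>)\<close> through derivatives of the components of \<open>G\<close> and
  brackets in the adapted frame.  Horizontal fields annihilate \<open>\<parallel>y\<parallel>\<close> because \<open>g\<close> is parallel, while
  the vertical derivative of \<open>\<parallel>y\<parallel>\<^sup>2\<close> is \<open>2 y\<^sub>k\<close>; brackets are vertical, with components \<open>y\<^sup>a K\<close> and \<open>\<Gamma>\<close>.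
  The curvature symmetries collapse the purely horizontal case, and nondegeneracy of \<open>g\<close> turns
  the resulting identities into the coefficients.  Tangent vectors are identified by their values
  on the coordinate functions.
\<close>

section \<open>Functions of class \<open>C\<^sup>k\<close>\<close>

text \<open>\<open>G\<close> pairs horizontal with vertical directions only. Testing
  \<open>Dbar\<close> of two frame fields against vertical fields therefore yields its horizontal
  components, and testing against horizontal fields yields the vertical ones; a vertical bracket is
  seen by horizontal fields alone. The nonzero components of \<open>G\<close> are g_ij times the
  factor 2 / N, where N is the fibre norm. Horizontal differentiation acts on g_ij alone, vertical
  differentiation on the factor alone, where it multiplies by - y_k / N^2. Dividing by the 2 of the
  Koszul formula gives every 1 / (2 N^2) in the result. The obstacle is that functions and vector
  fields are total while expansions in a frame hold over a chart domain only: an identity that is to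
  be differentiated, or inserted into a connection, has to pass through a locality lemma. The
  calculus is developed once for a chart of an abstract atlas and used for both the base and the
  slit bundle, which is why the slit atlas has to be proved smooth.\<close>

lemma Ck_on_cong:
  assumes "open S" and "\<And>x. x \<in> S \<Longrightarrow> f x = g x"
  shows "Ck_on k S f \<longleftrightarrow> Ck_on k S g"
proof -
  have "Ck_on k S g" if "Ck_on k S f" "\<And>x. x \<in> S \<Longrightarrow> f x = g x" for f g :: "'a \<Rightarrow> 'b"
    using that
  proof (induction k arbitrary: f g)
    case 0
    then show ?case by (simp cong: continuous_on_cong)
  next
    case (Suc k)
    have der: "(g has_derivative frechet_derivative f (at x)) (at x)" if "x \<in> S" for x
    proof -
      have "(f has_derivative frechet_derivative f (at x)) (at x)"
        using Suc.prems(1) that assms(1)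
        by (auto simp: differentiable_on_eq_differentiable_at frechet_derivative_works[symmetric])
      then show ?thesis
        using has_derivative_transform_within_open[OF _ assms(1) that] Suc.prems(2) by blast
    qed
    have "g differentiable_on S"
      using der assms(1) by (auto simp: differentiable_on_eq_differentiable_at differentiable_def)
    moreover have "Ck_on k S (\<lambda>x. frechet_derivative g (at x) v)" for v
      by (rule Suc.IH[of "\<lambda>x. frechet_derivative f (at x) v"])
        (use Suc.prems(1) frechet_derivative_at[OF der] in auto)
    ultimately show ?case by simp
  qed
  from this[of f g] this[of g f] show ?thesis using assms(2) by auto
qed

text \<open>\<open>Ck_on\<close> refers to the chosen \<open>frechet_derivative\<close>; on an open
  set derivatives are unique, so an explicit formula may take its place. Most closure properties
  below go through this rule.\<close>

lemma Ck_on_SucI: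
  assumes "open S" and "\<And>x. x \<in> S \<Longrightarrow> (f has_derivative f' x) (at x)"
    and "\<And>v. Ck_on k S (\<lambda>x. f' x v)"
  shows "Ck_on (Suc k) S f"
proof -
  have "f differentiable_on S"
    using assms by (auto simp: differentiable_on_eq_differentiable_at differentiable_def)
  moreover have "Ck_on k S (\<lambda>x. frechet_derivative f (at x) v)" for v
    by (rule Ck_on_cong[OF assms(1), THEN iffD1, OF _ assms(3)])
      (simp add: frechet_derivative_at[OF assms(2)])
  ultimately show ?thesis by simp
qed

lemma Ck_on_Suc_has_derivative:
  assumes "open S" "Ck_on (Suc k) S f" "x \<in> S"
  shows "(f has_derivative frechet_derivative f (at x)) (at x)"
  using assms by (auto simp: differentiable_on_eq_differentiable_at frechet_derivative_works[symmetric])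

lemma Ck_on_Suc_lower: "Ck_on (Suc k) S f \<Longrightarrow> Ck_on k S f"
  by (induction k arbitrary: f) (auto simp: differentiable_imp_continuous_on)

lemma Ck_on_subset: "Ck_on k S f \<Longrightarrow> T \<subseteq> S \<Longrightarrow> Ck_on k T f"
  by (induction k arbitrary: f) (auto intro: continuous_on_subset differentiable_on_subset)

lemma Ck_on_const: "open S \<Longrightarrow> Ck_on k S (\<lambda>x. b)"
  by (induction k arbitrary: b) auto

lemma Ck_on_add:
  assumes "open S" "Ck_on k S f" "Ck_on k S g"
  shows "Ck_on k S (\<lambda>x. f x + g x)"
  using assms(2,3)
proof (induction k arbitrary: f g)
  case 0
  then show ?case by (simp add: continuous_on_add)
next
  case (Suc k)
  show ?case
    by (rule Ck_on_SucI[OF assms(1) has_derivative_add[OF Ck_on_Suc_has_derivative Ck_on_Suc_has_derivative]])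
      (use Suc assms(1) in auto)
qed

lemma Ck_on_sum:
  assumes "open S" "\<And>i. i \<in> I \<Longrightarrow> Ck_on k S (f i)"
  shows "Ck_on k S (\<lambda>x. \<Sum>i\<in>I. f i x)"
  using assms by (induction I rule: infinite_finite_induct) (auto simp: Ck_on_const Ck_on_add)

lemma Ck_on_bounded_linear:
  assumes "open S" "Ck_on k S f" "bounded_linear L"
  shows "Ck_on k S (\<lambda>x. L (f x))"
  using assms(2)
proof (induction k arbitrary: f)
  case 0
  then show ?case using assms(3) by (simp add: linear_continuous_on_compose linear_linear bounded_linear.continuous_on)
next
  case (Suc k)
  show ?case
    by (rule Ck_on_SucI[OF assms(1) bounded_linear.has_derivative[OF assms(3) Ck_on_Suc_has_derivative]])
      (use Suc assms(1) in auto)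
qed

lemma Ck_on_linear:
  assumes "open S" "bounded_linear L"
  shows "Ck_on k S L"
proof (cases k)
  case 0
  then show ?thesis using assms(2) by (simp add: linear_continuous_on)
next
  case (Suc k)
  show ?thesis unfolding Suc
    by (rule Ck_on_SucI[OF assms(1) bounded_linear_imp_has_derivative[OF assms(2)]])
      (use assms(1) in \<open>auto simp: Ck_on_const\<close>)
qed

text \<open>The derivative is a sum of two terms of the same bilinear shape, each pairing a
  derivative with an undifferentiated factor. The induction closes once that factor is regarded as
  of class C^k instead of C^(k+1).\<close>

lemma Ck_on_bilinear:
  assumes "open S" "Ck_on k S f" "Ck_on k S g" "bounded_bilinear B"
  shows "Ck_on k S (\<lambda>x. B (f x) (g x))"
  using assms(2,3)
proof (induction k arbitrary: f g)
  case 0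
  then show ?case using assms(4) by (simp add: bounded_bilinear.continuous_on)
next
  case (Suc k)
  note low = Suc.prems[THEN Ck_on_Suc_lower]
  have der: "Ck_on k S (\<lambda>x. frechet_derivative f (at x) v)"
    "Ck_on k S (\<lambda>x. frechet_derivative g (at x) v)" for v
    using Suc.prems by simp_all
  show ?case
  proof (rule Ck_on_SucI[OF assms(1)])
    show "((\<lambda>x. B (f x) (g x)) has_derivative (\<lambda>v. B (f x) (frechet_derivative g (at x) v) +
        B (frechet_derivative f (at x) v) (g x))) (at x)" if "x \<in> S" for x
      using bounded_bilinear.FDERIV[OF assms(4) Ck_on_Suc_has_derivative[OF assms(1) Suc.prems(1) that]
          Ck_on_Suc_has_derivative[OF assms(1) Suc.prems(2) that]] by simp
    show "Ck_on k S (\<lambda>x. B (f x) (frechet_derivative g (at x) v) +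
        B (frechet_derivative f (at x) v) (g x))" for v
      by (rule Ck_on_add[OF assms(1) Suc.IH[OF low(1) der(2)] Suc.IH[OF der(1) low(2)]])
  qed
qed

text \<open>\<open>Ck_on\<close> speaks of derivatives in a fixed direction, whereas the chain rule
  differentiates \<open>g\<close> in the direction \<open>?f' x v\<close>, which moves with
  \<open>x\<close>. Expanding that direction in \<open>Basis\<close> leaves fixed directions with
  scalar coefficients, to which the induction hypothesis and the product rule apply.\<close>

lemma Ck_on_compose:
  fixes f :: "'a::euclidean_space \<Rightarrow> 'b::euclidean_space" and g :: "'b \<Rightarrow> 'c::real_normed_vector"
  assumes "open S" "open T" "Ck_on k T g" "Ck_on k S f" "f ` S \<subseteq> T"
  shows "Ck_on k S (\<lambda>x. g (f x))"
  using assms(3,4)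
proof (induction k arbitrary: g)
  case 0
  then show ?case using assms(5) continuous_on_compose2 by auto
next
  case (Suc k)
  let ?f' = "\<lambda>x. frechet_derivative f (at x)" and ?g' = "\<lambda>x. frechet_derivative g (at x)"
  have fx: "f x \<in> T" if "x \<in> S" for x using assms(5) that by auto
  have exp: "?g' (f x) w = (\<Sum>b\<in>Basis. (w \<bullet> b) *\<^sub>R ?g' (f x) b)" if "x \<in> S" for x w
  proof -
    have "linear (?g' (f x))"
      using Ck_on_Suc_has_derivative[OF assms(2) Suc.prems(1) fx[OF that]] has_derivative_linear by blast
    then have "?g' (f x) (\<Sum>b\<in>Basis. (w \<bullet> b) *\<^sub>R b) = (\<Sum>b\<in>Basis. (w \<bullet> b) *\<^sub>R ?g' (f x) b)"
      by (simp add: linear_sum linear_cmul)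
    then show ?thesis by (simp add: euclidean_representation)
  qed
  have "((\<lambda>x. g (f x)) has_derivative (\<lambda>v. \<Sum>b\<in>Basis. (?f' x v \<bullet> b) *\<^sub>R ?g' (f x) b)) (at x)"
    if "x \<in> S" for x
  proof -
    have "((\<lambda>x. g (f x)) has_derivative (\<lambda>v. ?g' (f x) (?f' x v))) (at x)"
      by (rule has_derivative_compose[OF Ck_on_Suc_has_derivative[OF assms(1) Suc.prems(2) that]
          Ck_on_Suc_has_derivative[OF assms(2) Suc.prems(1) fx[OF that]]])
    then show ?thesis by (rule has_derivative_eq_rhs) (rule ext, rule exp[OF that])
  qed
  moreover have "Ck_on k S (\<lambda>x. \<Sum>b\<in>Basis. (?f' x v \<bullet> b) *\<^sub>R ?g' (f x) b)" for v
  proof (intro Ck_on_sum Ck_on_bilinear[OF _ _ _ bounded_bilinear_scaleR] assms(1))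
    fix b :: 'b
    show "Ck_on k S (\<lambda>x. ?f' x v \<bullet> b)"
      using Suc.prems(2)
      by (intro Ck_on_bounded_linear[OF _ _ bounded_linear_inner_left] assms(1)) simp
    show "Ck_on k S (\<lambda>x. ?g' (f x) b)"
      by (rule Suc.IH[OF _ Ck_on_Suc_lower[OF Suc.prems(2)]]) (use Suc.prems(1) in simp)
  qed
  ultimately show ?case by (rule Ck_on_SucI[OF assms(1)])
qed

text \<open>Prefactor and exponent are kept arbitrary so that the family is closed under
  differentiation. The lift requires the exponent -1/2.\<close>

lemma Ck_on_powr: "Ck_on k {0<..} (\<lambda>t::real. a * t powr b)"
proof (induction k arbitrary: a b)
  case 0
  then show ?case by (auto intro!: continuous_intros)
next
  case (Suc k)
  have "((\<lambda>t. a * t powr b) has_derivative (\<lambda>v. v * (a * b * t powr (b - 1)))) (at t)"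
    if "t \<in> {0<..}" for t
    using that by (auto intro!: derivative_eq_intros simp: powr_diff)
  moreover have "Ck_on k {0<..} (\<lambda>t. v * (a * b * t powr (b - 1)))" for v
    using Suc.IH[of "v * a * b" "b - 1"] by (simp add: mult.assoc)
  ultimately show ?case by (intro Ck_on_SucI) auto
qed

section \<open>Closure properties of smooth maps\<close>

lemma smooth_on_cong:
  "open S \<Longrightarrow> (\<And>x. x \<in> S \<Longrightarrow> f x = g x) \<Longrightarrow> smooth_on S f \<longleftrightarrow> smooth_on S g"
  by (simp add: smooth_on_def Ck_on_cong[of S f g])

lemma smooth_on_eqI:
  "open S \<Longrightarrow> smooth_on S g \<Longrightarrow> (\<And>x. x \<in> S \<Longrightarrow> f x = g x) \<Longrightarrow> smooth_on S f"
  by (simp add: smooth_on_cong[of S f g])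

lemma smooth_on_subset: "smooth_on S f \<Longrightarrow> T \<subseteq> S \<Longrightarrow> smooth_on T f"
  by (auto simp: smooth_on_def intro: Ck_on_subset)

lemma smooth_on_has_derivative:
  "open S \<Longrightarrow> smooth_on S f \<Longrightarrow> x \<in> S \<Longrightarrow> (f has_derivative frechet_derivative f (at x)) (at x)"
  unfolding smooth_on_def by (rule Ck_on_Suc_has_derivative[of _ 0]) blast+

lemma smooth_on_frechet_derivative:
  "smooth_on S f \<Longrightarrow> smooth_on S (\<lambda>x. frechet_derivative f (at x) v)"
  using Ck_on.simps(2)[of _ S f] unfolding smooth_on_def by blast

lemma smooth_on_imp_continuous_on: "smooth_on S f \<Longrightarrow> continuous_on S f"
  using Ck_on.simps(1)[of S f] unfolding smooth_on_def by blast

lemma smooth_on_const: "open S \<Longrightarrow> smooth_on S (\<lambda>x. b)"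
  by (simp add: smooth_on_def Ck_on_const)

lemma smooth_on_add:
  "open S \<Longrightarrow> smooth_on S f \<Longrightarrow> smooth_on S g \<Longrightarrow> smooth_on S (\<lambda>x. f x + g x)"
  by (simp add: smooth_on_def Ck_on_add)

lemma smooth_on_sum:
  "open S \<Longrightarrow> (\<And>i. i \<in> I \<Longrightarrow> smooth_on S (f i)) \<Longrightarrow> smooth_on S (\<lambda>x. \<Sum>i\<in>I. f i x)"
  by (simp add: smooth_on_def Ck_on_sum)

lemma smooth_on_linear: "open S \<Longrightarrow> bounded_linear L \<Longrightarrow> smooth_on S L"
  by (simp add: smooth_on_def Ck_on_linear)

lemma smooth_on_bounded_linear:
  "open S \<Longrightarrow> smooth_on S f \<Longrightarrow> bounded_linear L \<Longrightarrow> smooth_on S (\<lambda>x. L (f x))"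
  by (simp add: smooth_on_def Ck_on_bounded_linear)

lemma smooth_on_bilinear:
  "open S \<Longrightarrow> smooth_on S f \<Longrightarrow> smooth_on S g \<Longrightarrow> bounded_bilinear B \<Longrightarrow>
    smooth_on S (\<lambda>x. B (f x) (g x))"
  by (simp add: smooth_on_def Ck_on_bilinear)

lemma smooth_on_compose:
  fixes f :: "'a::euclidean_space \<Rightarrow> 'b::euclidean_space" and g :: "'b \<Rightarrow> 'c::real_normed_vector"
  shows "open S \<Longrightarrow> open T \<Longrightarrow> smooth_on T g \<Longrightarrow> smooth_on S f \<Longrightarrow> f ` S \<subseteq> T \<Longrightarrow>
    smooth_on S (\<lambda>x. g (f x))"
  by (simp add: smooth_on_def Ck_on_compose)

lemma smooth_on_Pair:
  fixes f :: "'a::euclidean_space \<Rightarrow> 'b::euclidean_space" and g :: "'a \<Rightarrow> 'c::euclidean_space"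
  assumes "open S" "smooth_on S f" "smooth_on S g"
  shows "smooth_on S (\<lambda>x. (f x, g x))"
proof -
  have "smooth_on S (\<lambda>x. (f x, 0) + (0, g x))"
    by (intro smooth_on_add smooth_on_bounded_linear[where L = "\<lambda>u. (u, 0)"]
        smooth_on_bounded_linear[where L = "\<lambda>u. (0, u)"] assms bounded_linear_Pair
        bounded_linear_ident bounded_linear_zero)
  then show ?thesis by simp
qed

section \<open>Calculus in a chart of a smooth atlas\<close>

text \<open>The model space is an arbitrary Euclidean space because the locale serves twice: for
  charts of \<open>A\<close> and for charts of the slit bundle, whose coordinates are pairs.\<close>

locale atlas_chart =
  fixes A :: "('p, 'e::euclidean_space) chart set" and c :: "('p, 'e) chart"
  assumes atlas: "smooth_atlas A" and chart: "c \<in> A"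
begin

abbreviation "Z \<equiv> snd c ` fst c"

lemma inj_chart: "inj_on (snd c) (fst c)"
  and open_Z: "open Z"
  using atlas chart by (auto simp: smooth_atlas_def is_chart_def)

lemma inv_chart [simp]: "p \<in> fst c \<Longrightarrow> inv_chart c (snd c p) = p"
  using inj_chart by (simp add: inv_chart_def)

lemma chart_inv: "z \<in> Z \<Longrightarrow> snd c (inv_chart c z) = z"
  and inv_chart_in: "z \<in> Z \<Longrightarrow> inv_chart c z \<in> fst c"
  by (auto simp: inv_chart_def f_inv_into_f inv_into_into)

lemma atlas_open_chart: "atlas_open A (fst c)"
  unfolding atlas_open_def points_def
proof (intro conjI ballI)
  fix d assume "d \<in> A"
  then have "compatible d c" using atlas chart by (auto simp: smooth_atlas_def)
  then show "open (snd d ` (fst d \<inter> fst c))" by (simp add: compatible_def)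
qed (use chart in auto)

lemma in_points: "p \<in> fst c \<Longrightarrow> p \<in> points A"
  using chart by (auto simp: points_def)

lemma transition:
  assumes "d \<in> A"
  defines "T \<equiv> snd c ` (fst c \<inter> fst d)"
  shows "open T" "smooth_on T (snd d \<circ> inv_chart c)"
    "z \<in> T \<Longrightarrow> snd d (inv_chart c z) \<in> snd d ` (fst c \<inter> fst d)"
    "z \<in> T \<Longrightarrow> inv_chart d (snd d (inv_chart c z)) = inv_chart c z"
proof -
  have "compatible c d" using atlas chart assms by (auto simp: smooth_atlas_def)
  then show "open T" "smooth_on T (snd d \<circ> inv_chart c)" by (simp_all add: compatible_def T_def)
  interpret d: atlas_chart A d using atlas assms by unfold_locales
  show "snd d (inv_chart c z) \<in> snd d ` (fst c \<inter> fst d)"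
    "inv_chart d (snd d (inv_chart c z)) = inv_chart c z" if "z \<in> T"
    using that by (auto simp: T_def)
qed

text \<open>Smoothness witnessed in some chart \<open>d\<close> passes to \<open>c\<close> by
  composition with the transition map, on the preimage of the witnessing neighbourhood.\<close>

lemma smooth_at_iff:
  assumes "p \<in> fst c"
  shows "smooth_at A p f \<longleftrightarrow>
    (\<exists>S. open S \<and> snd c p \<in> S \<and> S \<subseteq> Z \<and> smooth_on S (f \<circ> inv_chart c))"
proof
  assume "smooth_at A p f"
  then obtain d S where d: "d \<in> A" "p \<in> fst d" and S: "open S" "snd d p \<in> S" "S \<subseteq> snd d ` fst d"
    and f: "smooth_on S (f \<circ> inv_chart d)"
    unfolding smooth_at_def by blast
  interpret d: atlas_chart A d using atlas d by unfold_locales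
  let ?T = "snd c ` (fst c \<inter> fst d)" and ?t = "snd d \<circ> inv_chart c"
  define S' where "S' = ?T \<inter> ?t -` S"
  note t = transition[OF d(1)]
  have S': "open S'"
    unfolding S'_def
    using t(1,2) S(1) by (intro continuous_open_preimage smooth_on_imp_continuous_on)
  have "smooth_on S' (\<lambda>z. (f \<circ> inv_chart d) (?t z))"
    by (rule smooth_on_compose[OF S' S(1) f smooth_on_subset[OF t(2)]]) (auto simp: S'_def)
  then have "smooth_on S' (f \<circ> inv_chart c)"
    using t(4) by (subst smooth_on_cong[OF S', where g = "\<lambda>z. (f \<circ> inv_chart d) (?t z)"]) (auto simp: S'_def)
  moreover have "snd c p \<in> S'" "S' \<subseteq> Z" using assms d S by (auto simp: S'_def)
  ultimately show "\<exists>S. open S \<and> snd c p \<in> S \<and> S \<subseteq> Z \<and> smooth_on S (f \<circ> inv_chart c)"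
    using S' by blast
next
  assume "\<exists>S. open S \<and> snd c p \<in> S \<and> S \<subseteq> Z \<and> smooth_on S (f \<circ> inv_chart c)"
  then show "smooth_at A p f" using assms chart unfolding smooth_at_def by blast
qed

lemma smooth_atI:
  "p \<in> fst c \<Longrightarrow> smooth_on Z (f \<circ> inv_chart c) \<Longrightarrow> smooth_at A p f"
  unfolding smooth_at_iff using open_Z by blast

text \<open>From left to right every point has its own neighbourhood, and these have to be patched
  to all of \<open>Z\<close>. Continuity, differentiability and the value of the derivative at a
  point are local, so an induction on the order, for an arbitrary function, shows that being of
  class C^k is local as well.\<close>

lemma smooth_fun_iff: "smooth_fun A (fst c) f \<longleftrightarrow> smooth_on Z (f \<circ> inv_chart c)"
proof
  assume f: "smooth_fun A (fst c) f"
  have "Ck_on k Z (f \<circ> inv_chart c)" for k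
  proof -
    have loc: "\<exists>S. open S \<and> z \<in> S \<and> S \<subseteq> Z \<and> smooth_on S (f \<circ> inv_chart c)" if "z \<in> Z" for z
      using f that inv_chart_in[OF that] chart_inv[OF that] smooth_at_iff by (metis smooth_fun_def)
    have "Ck_on k Z h" if "\<And>z. z \<in> Z \<Longrightarrow> \<exists>S. open S \<and> z \<in> S \<and> S \<subseteq> Z \<and> Ck_on k S h" for h :: "'e \<Rightarrow> real"
      using that
    proof (induction k arbitrary: h)
      case 0
      then show ?case
        by (metis Ck_on.simps(1) continuous_at_imp_continuous_on continuous_on_eq_continuous_at)
    next
      case (Suc k)
      show ?case
      proof (rule Ck_on_SucI[OF open_Z])
        show "(h has_derivative frechet_derivative h (at z)) (at z)" if "z \<in> Z" for z
          using Suc.prems[OF that] Ck_on_Suc_has_derivative by blast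
        show "Ck_on k Z (\<lambda>z. frechet_derivative h (at z) v)" for v
          by (rule Suc.IH) (use Suc.prems in fastforce)
      qed
    qed
    then show ?thesis using loc by (metis smooth_on_def)
  qed
  then show "smooth_on Z (f \<circ> inv_chart c)" by (simp add: smooth_on_def)
qed (auto simp: smooth_fun_def smooth_atI)

lemma smooth_at_cong:
  assumes "p \<in> fst c" "\<And>r. r \<in> fst c \<Longrightarrow> f r = g r"
  shows "smooth_at A p f \<longleftrightarrow> smooth_at A p g"
proof -
  have "smooth_on S (f \<circ> inv_chart c) \<longleftrightarrow> smooth_on S (g \<circ> inv_chart c)" if "open S" "S \<subseteq> Z" for S
    using that assms(2) inv_chart_in by (intro smooth_on_cong) auto
  then show ?thesis unfolding smooth_at_iff[OF assms(1)] by blast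
qed

section \<open>Coordinate vectors as derivations and their calculus rules\<close>

lemma smooth_at_has_derivative:
  assumes "p \<in> fst c" "smooth_at A p f"
  shows "((f \<circ> inv_chart c) has_derivative (\<lambda>e. coord_vec A c p e f)) (at (snd c p))"
proof -
  have "((f \<circ> inv_chart c) has_derivative frechet_derivative (f \<circ> inv_chart c) (at (snd c p))) (at (snd c p))"
    using assms smooth_on_has_derivative unfolding smooth_at_iff[OF assms(1)] by blast
  then show ?thesis by (rule has_derivative_eq_rhs) (simp add: coord_vec_def assms(2))
qed

lemma coord_vec_eqI:
  assumes "p \<in> fst c" "smooth_at A p f" "((f \<circ> inv_chart c) has_derivative f') (at (snd c p))"
  shows "coord_vec A c p e f = f' e"
  using has_derivative_unique[OF smooth_at_has_derivative[OF assms(1,2)] assms(3)] by metis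

text \<open>Derivations see only values over the chart domain. This permits differentiating
  identities, such as formulas for frame components, that are known over the chart domain
  alone.\<close>

lemma coord_vec_cong:
  assumes "p \<in> fst c" "\<And>r. r \<in> fst c \<Longrightarrow> f r = g r"
  shows "coord_vec A c p e f = coord_vec A c p e g"
proof (cases "smooth_at A p g")
  case True
  have f: "smooth_at A p f" using True smooth_at_cong[OF assms] by simp
  have "((f \<circ> inv_chart c) has_derivative (\<lambda>e. coord_vec A c p e g)) (at (snd c p))"
    using has_derivative_transform_within_open[OF smooth_at_has_derivative[OF assms(1) True] open_Z]
      assms inv_chart_in by simp
  then show ?thesis using coord_vec_eqI[OF assms(1) f] by blast
next
  case False
  then show ?thesis using smooth_at_cong[OF assms] by (simp add: coord_vec_def)
qed

lemma smooth_at_const: "p \<in> fst c \<Longrightarrow> smooth_at A p (\<lambda>r. a)"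
  by (rule smooth_atI) (simp_all add: comp_def smooth_on_const open_Z)

lemma smooth_at_binary:
  fixes B :: "real \<Rightarrow> real \<Rightarrow> real"
  assumes "p \<in> fst c" "smooth_at A p f" "smooth_at A p g"
    and "\<And>S. open S \<Longrightarrow> smooth_on S (f \<circ> inv_chart c) \<Longrightarrow> smooth_on S (g \<circ> inv_chart c) \<Longrightarrow>
      smooth_on S (\<lambda>z. B (f (inv_chart c z)) (g (inv_chart c z)))"
  shows "smooth_at A p (\<lambda>r. B (f r) (g r))"
proof -
  obtain S T where "open S" "snd c p \<in> S" "S \<subseteq> Z" "smooth_on S (f \<circ> inv_chart c)"
    and "open T" "snd c p \<in> T" "smooth_on T (g \<circ> inv_chart c)"
    using assms(1-3) unfolding smooth_at_iff[OF assms(1)] by blast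
  then show ?thesis unfolding smooth_at_iff[OF assms(1)]
    using assms(4)[of "S \<inter> T"] by (intro exI[of _ "S \<inter> T"]) (auto intro: smooth_on_subset simp: comp_def)
qed

lemma smooth_at_add:
  assumes "p \<in> fst c" "smooth_at A p f" "smooth_at A p g"
  shows "smooth_at A p (\<lambda>r. f r + g r)"
  using assms by (rule smooth_at_binary[where B = "(+)"]) (simp add: comp_def smooth_on_add)

lemma smooth_at_mult:
  assumes "p \<in> fst c" "smooth_at A p f" "smooth_at A p g"
  shows "smooth_at A p (\<lambda>r. f r * g r)"
  using assms by (rule smooth_at_binary[where B = "(*)"])
    (simp add: comp_def smooth_on_bilinear[OF _ _ _ bounded_bilinear_mult])

lemma smooth_at_sum:
  assumes "p \<in> fst c" "\<And>i. i \<in> I \<Longrightarrow> smooth_at A p (f i)"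
  shows "smooth_at A p (\<lambda>r. \<Sum>i\<in>I. f i r)"
  using assms(2) by (induction I rule: infinite_finite_induct)
    (auto simp: smooth_at_const[OF assms(1)] smooth_at_add[OF assms(1)])

lemma smooth_at_linear_coord:
  assumes "p \<in> fst c" "bounded_linear (L :: 'e \<Rightarrow> real)"
  shows "smooth_at A p (\<lambda>r. L (snd c r))"
proof (rule smooth_atI[OF assms(1)])
  have "smooth_on Z L" using open_Z assms by (simp add: smooth_on_linear)
  then show "smooth_on Z ((\<lambda>r. L (snd c r)) \<circ> inv_chart c)"
    by (subst smooth_on_cong[OF open_Z, where g = L]) (auto simp: chart_inv)
qed

lemma smooth_at_powr:
  assumes "p \<in> fst c" "smooth_fun A (fst c) f" "\<And>r. r \<in> fst c \<Longrightarrow> f r > 0"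
  shows "smooth_at A p (\<lambda>r. f r powr b)"
proof (rule smooth_atI[OF assms(1)])
  have "smooth_on {0<..} (\<lambda>t::real. t powr b)" using Ck_on_powr[of _ 1 b] by (simp add: smooth_on_def)
  then show "smooth_on Z ((\<lambda>r. f r powr b) \<circ> inv_chart c)"
    using smooth_on_compose[OF open_Z open_greaterThan _ assms(2)[unfolded smooth_fun_iff], of 0 "\<lambda>t. t powr b"]
      assms(3) inv_chart_in by (simp add: comp_def image_subset_iff)
qed

lemma coord_vec_const: "p \<in> fst c \<Longrightarrow> coord_vec A c p e (\<lambda>r. a) = 0"
  by (rule coord_vec_eqI[where f' = "\<lambda>e. 0"]) (simp_all add: smooth_at_const comp_def)

lemma coord_vec_add_fun:
  assumes "p \<in> fst c" "smooth_at A p f" "smooth_at A p g"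
  shows "coord_vec A c p e (\<lambda>r. f r + g r) = coord_vec A c p e f + coord_vec A c p e g"
  using has_derivative_add[OF smooth_at_has_derivative[OF assms(1,2)] smooth_at_has_derivative[OF assms(1,3)]]
  by (intro coord_vec_eqI assms(1) smooth_at_add assms) (simp add: comp_def)

lemma coord_vec_mult_fun:
  assumes "p \<in> fst c" "smooth_at A p f" "smooth_at A p g"
  shows "coord_vec A c p e (\<lambda>r. f r * g r) = f p * coord_vec A c p e g + g p * coord_vec A c p e f"
proof -
  have "((\<lambda>r. f r * g r) \<circ> inv_chart c has_derivative
     (\<lambda>e. f p * coord_vec A c p e g + g p * coord_vec A c p e f)) (at (snd c p))"
    using has_derivative_mult[OF smooth_at_has_derivative[OF assms(1,2)] smooth_at_has_derivative[OF assms(1,3)]] assms(1)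
    by (simp add: comp_def mult.commute)
  then show ?thesis by (rule coord_vec_eqI[OF assms(1) smooth_at_mult[OF assms]])
qed

lemma coord_vec_sum_fun:
  assumes "p \<in> fst c" "\<And>i. i \<in> I \<Longrightarrow> smooth_at A p (f i)"
  shows "coord_vec A c p e (\<lambda>r. \<Sum>i\<in>I. f i r) = (\<Sum>i\<in>I. coord_vec A c p e (f i))"
  using assms(2) by (induction I rule: infinite_finite_induct)
    (auto simp: coord_vec_const[OF assms(1)] coord_vec_add_fun[OF assms(1)] smooth_at_sum[OF assms(1)])

lemma coord_vec_linear_coord:
  assumes "p \<in> fst c" "bounded_linear (L :: 'e \<Rightarrow> real)"
  shows "coord_vec A c p e (\<lambda>r. L (snd c r)) = L e"
proof (rule coord_vec_eqI[OF assms(1) smooth_at_linear_coord[OF assms]])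
  show "((\<lambda>r. L (snd c r)) \<circ> inv_chart c has_derivative L) (at (snd c p))"
    by (rule has_derivative_transform_within_open[OF bounded_linear_imp_has_derivative[OF assms(2)] open_Z])
      (use assms(1) in \<open>auto simp: chart_inv\<close>)
qed

lemma coord_vec_powr_fun:
  assumes "p \<in> fst c" "smooth_fun A (fst c) f" "\<And>r. r \<in> fst c \<Longrightarrow> f r > 0"
  shows "coord_vec A c p e (\<lambda>r. f r powr b) = b * f p powr (b - 1) * coord_vec A c p e f"
proof (rule coord_vec_eqI[OF assms(1) smooth_at_powr[OF assms]])
  have f: "smooth_at A p f" using assms by (auto simp: smooth_fun_def)
  have "((\<lambda>t. t powr b) has_derivative (\<lambda>v. b * f p powr (b - 1) * v)) (at (f p))"
    using assms(3)[OF assms(1)] by (auto intro!: derivative_eq_intros simp: powr_diff fun_eq_iff)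
  then show "((\<lambda>r. f r powr b) \<circ> inv_chart c has_derivative
      (\<lambda>e. b * f p powr (b - 1) * coord_vec A c p e f)) (at (snd c p))"
    using has_derivative_compose[OF smooth_at_has_derivative[OF assms(1) f], of "\<lambda>t. t powr b"] assms(1)
    by (simp add: comp_def)
qed

section \<open>The tangent space described by a single chart\<close>

lemma linear_coord_vec:
  assumes "p \<in> fst c"
  shows "linear (\<lambda>e. coord_vec A c p e f)"
proof (cases "smooth_at A p f")
  case True
  then show ?thesis using smooth_at_has_derivative[OF assms True] has_derivative_linear by blast
next
  case False
  then show ?thesis by (simp add: coord_vec_def linear_zero)
qed

text \<open>For \<open>f\<close> smooth at \<open>p\<close> this is the chain rule. On all other
  functions both operators take the default value 0, so they agree as operators.\<close>

lemma coord_vec_transition: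
  assumes "d \<in> A" "p \<in> fst c" "p \<in> fst d"
  shows "coord_vec A c p e =
    coord_vec A d p (frechet_derivative (snd d \<circ> inv_chart c) (at (snd c p)) e)"
proof
  fix f
  interpret d: atlas_chart A d using atlas assms by unfold_locales
  let ?T = "snd c ` (fst c \<inter> fst d)" and ?t = "snd d \<circ> inv_chart c"
  note t = transition[OF assms(1)]
  have p: "snd c p \<in> ?T" using assms by auto
  show "coord_vec A c p e f = coord_vec A d p (frechet_derivative ?t (at (snd c p)) e) f"
  proof (cases "smooth_at A p f")
    case True
    have tp: "?t (snd c p) = snd d p" using assms by simp
    have "((\<lambda>z. (f \<circ> inv_chart d) (?t z)) has_derivative
        (\<lambda>e. coord_vec A d p (frechet_derivative ?t (at (snd c p)) e) f)) (at (snd c p))"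
      by (rule has_derivative_compose[OF smooth_on_has_derivative[OF t(1,2) p]])
        (use d.smooth_at_has_derivative[OF assms(3) True] in \<open>simp add: tp assms(2) comp_def\<close>)
    then have "((f \<circ> inv_chart c) has_derivative
        (\<lambda>e. coord_vec A d p (frechet_derivative ?t (at (snd c p)) e) f)) (at (snd c p))"
      by (rule has_derivative_transform_within_open[OF _ t(1) p]) (simp add: t(4))
    then show ?thesis by (rule coord_vec_eqI[OF assms(2) True])
  qed (simp add: coord_vec_def)
qed

lemma tangent_space_eq:
  assumes "p \<in> fst c"
  shows "tangent_space A p = range (coord_vec A c p)"
proof -
  have "coord_vec A d p e \<in> range (coord_vec A c p)" if "d \<in> A" "p \<in> fst d" for d e
  proof -
    interpret d: atlas_chart A d using atlas that by unfold_locales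
    show ?thesis using d.coord_vec_transition[OF chart that(2) assms] by auto
  qed
  then show ?thesis using assms chart unfolding tangent_space_def by blast
qed

lemma coord_vec_in_tangent: "p \<in> fst c \<Longrightarrow> coord_vec A c p e \<in> tangent_space A p"
  by (simp add: tangent_space_eq)

lemma coord_vec_sum:
  assumes "p \<in> fst c"
  shows "coord_vec A c p (\<Sum>i\<in>I. a i *\<^sub>R e i) = (\<lambda>f. \<Sum>i\<in>I. a i * coord_vec A c p (e i) f)"
proof
  fix f
  interpret linear "\<lambda>e. coord_vec A c p e f" by (rule linear_coord_vec[OF assms])
  show "coord_vec A c p (\<Sum>i\<in>I. a i *\<^sub>R e i) f = (\<Sum>i\<in>I. a i * coord_vec A c p (e i) f)"
    by (simp add: sum scaleR)
qed

lemma coord_vec_combine: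
  assumes "p \<in> fst c"
  shows "coord_vec A c p (a *\<^sub>R e + b *\<^sub>R e') = (\<lambda>f. a * coord_vec A c p e f + b * coord_vec A c p e' f)"
proof
  fix f
  interpret linear "\<lambda>e. coord_vec A c p e f" by (rule linear_coord_vec[OF assms])
  show "coord_vec A c p (a *\<^sub>R e + b *\<^sub>R e') f = a * coord_vec A c p e f + b * coord_vec A c p e' f"
    by (simp add: add scaleR)
qed

lemma coord_vec_0: "p \<in> fst c \<Longrightarrow> coord_vec A c p 0 = (\<lambda>f. 0)"
  using coord_vec_combine[of p 0 0 0 0] by simp

text \<open>The components of \<open>e\<close> are recovered by evaluating the vector on linear
  functions of the coordinates.\<close>

lemma coord_vec_inject:
  assumes "p \<in> fst c"
  shows "coord_vec A c p e = coord_vec A c p e' \<longleftrightarrow> e = e'"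
proof
  assume "coord_vec A c p e = coord_vec A c p e'"
  then have "e \<bullet> b = e' \<bullet> b" for b
    using coord_vec_linear_coord[OF assms bounded_linear_inner_left[of b]] by metis
  then show "e = e'" by (metis euclidean_eqI)
qed simp

lemma tangent_combine:
  assumes "p \<in> fst c" "u \<in> tangent_space A p" "v \<in> tangent_space A p"
  shows "(\<lambda>f. a * u f + b * v f) \<in> tangent_space A p"
  using assms coord_vec_combine[OF assms(1)] unfolding tangent_space_eq[OF assms(1)]
  by (auto simp: image_iff) metis

lemma tangent_sum:
  assumes "p \<in> fst c" "\<And>i. i \<in> I \<Longrightarrow> v i \<in> tangent_space A p"
  shows "(\<lambda>f. \<Sum>i\<in>I. a i * v i f) \<in> tangent_space A p"
proof -
  have "\<exists>e. \<forall>i\<in>I. v i = coord_vec A c p (e i)"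
    using assms by (intro bchoice) (auto simp: tangent_space_eq)
  then obtain e where "\<forall>i\<in>I. v i = coord_vec A c p (e i)" by blast
  then have "(\<lambda>f. \<Sum>i\<in>I. a i * v i f) = coord_vec A c p (\<Sum>i\<in>I. a i *\<^sub>R e i)"
    by (simp add: coord_vec_sum[OF assms(1)])
  then show ?thesis by (simp add: coord_vec_in_tangent assms(1))
qed

lemma tangent_cong:
  assumes "p \<in> fst c" "v \<in> tangent_space A p" "\<And>r. r \<in> fst c \<Longrightarrow> f r = g r"
  shows "v f = v g"
  using assms coord_vec_cong[of p f g] by (auto simp: tangent_space_eq)

lemma tangent_const: "p \<in> fst c \<Longrightarrow> v \<in> tangent_space A p \<Longrightarrow> v (\<lambda>r. a) = 0"
  by (auto simp: tangent_space_eq coord_vec_const)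

lemma tangent_sum_fun:
  "p \<in> fst c \<Longrightarrow> v \<in> tangent_space A p \<Longrightarrow> (\<And>i. i \<in> I \<Longrightarrow> smooth_at A p (f i)) \<Longrightarrow>
    v (\<lambda>r. \<Sum>i\<in>I. f i r) = (\<Sum>i\<in>I. v (f i))"
  by (auto simp: tangent_space_eq coord_vec_sum_fun)

lemma tangent_mult_fun:
  "p \<in> fst c \<Longrightarrow> v \<in> tangent_space A p \<Longrightarrow> smooth_at A p f \<Longrightarrow> smooth_at A p g \<Longrightarrow>
    v (\<lambda>r. f r * g r) = f p * v g + g p * v f"
  by (auto simp: tangent_space_eq coord_vec_mult_fun)

lemma tangent_powr_fun:
  "p \<in> fst c \<Longrightarrow> v \<in> tangent_space A p \<Longrightarrow> smooth_fun A (fst c) f \<Longrightarrow> (\<And>r. r \<in> fst c \<Longrightarrow> f r > 0) \<Longrightarrow>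
    v (\<lambda>r. f r powr b) = b * f p powr (b - 1) * v f"
  by (auto simp: tangent_space_eq coord_vec_powr_fun)

section \<open>Smooth vector fields on the chart domain\<close>

abbreviation "VF \<equiv> vector_fields A (fst c)"

lemma vector_field_tangent: "X \<in> VF \<Longrightarrow> p \<in> fst c \<Longrightarrow> X p \<in> tangent_space A p"
  by (simp add: vector_fields_def)

lemma vector_field_smooth: "X \<in> VF \<Longrightarrow> p \<in> fst c \<Longrightarrow> smooth_at A p f \<Longrightarrow> smooth_at A p (\<lambda>r. X r f)"
  by (simp add: vector_fields_def)

lemma vector_field_cong:
  assumes "X \<in> VF" "\<And>p. p \<in> fst c \<Longrightarrow> X p = Y p"
  shows "Y \<in> VF"
  using assms smooth_at_cong[where f = "\<lambda>r. X r f" and g = "\<lambda>r. Y r f" for f]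
  by (auto simp: vector_fields_def)

lemma coord_vec_field: "(\<lambda>p. coord_vec A c p e) \<in> VF"
  unfolding vector_fields_def
proof (intro CollectI ballI conjI allI impI coord_vec_in_tangent)
  fix p f assume p: "p \<in> fst c" and f: "smooth_at A p f"
  obtain S where S: "open S" "snd c p \<in> S" "S \<subseteq> Z" "smooth_on S (f \<circ> inv_chart c)"
    using f smooth_at_iff[OF p] by blast
  \<comment> \<open>Smoothness of \<open>f\<close> persists at all points of \<open>S\<close>, so
    the default value in \<open>coord_vec\<close> does not occur there.\<close>
  have "coord_vec A c (inv_chart c z) e f = frechet_derivative (f \<circ> inv_chart c) (at z) e" if "z \<in> S" for z
  proof -
    have z: "z \<in> Z" using that S(3) by auto
    then have "smooth_at A (inv_chart c z) f"
      using smooth_at_iff[OF inv_chart_in[OF z]] S that chart_inv[OF z] by auto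
    then show ?thesis by (simp add: coord_vec_def chart_inv[OF z])
  qed
  then have "smooth_on S ((\<lambda>r. coord_vec A c r e f) \<circ> inv_chart c)"
    using smooth_on_frechet_derivative[OF S(4), of e]
    by (subst smooth_on_cong[OF S(1), where g = "\<lambda>z. frechet_derivative (f \<circ> inv_chart c) (at z) e"]) auto
  then show "smooth_at A p (\<lambda>r. coord_vec A c r e f)"
    using S smooth_at_iff[OF p] by blast
qed

lemma vector_field_sum:
  assumes "\<And>i. i \<in> I \<Longrightarrow> X i \<in> VF" "\<And>i. i \<in> I \<Longrightarrow> smooth_fun A (fst c) (h i)"
  shows "(\<lambda>p f. \<Sum>i\<in>I. h i p * X i p f) \<in> VF"
  using assms unfolding vector_fields_def[of A]
  by (auto intro!: tangent_sum smooth_at_sum smooth_at_mult simp: smooth_fun_def)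

lemma vector_field_scale:
  assumes "X \<in> VF" "smooth_fun A (fst c) h"
  shows "(\<lambda>p f. h p * X p f) \<in> VF"
  using vector_field_sum[of "{()}" "\<lambda>_. X" "\<lambda>_. h"] assms by simp

lemma vector_field_add:
  assumes "X \<in> VF" "Y \<in> VF"
  shows "(\<lambda>p f. X p f + Y p f) \<in> VF"
  using vector_field_sum[of "UNIV :: bool set" "\<lambda>b. if b then X else Y" "\<lambda>_ _. 1"] assms
  by (simp add: UNIV_bool smooth_fun_def smooth_at_const add.commute)

end

section \<open>The slit tangent bundle\<close>

locale slit = atlas_chart A c for A :: "('p, real^'n::finite) chart set" and c
begin

lemma fibre_coord_coord_vec:
  "p \<in> fst c \<Longrightarrow> fibre_coord c (p, coord_vec A c p e) i = e $ i"
  by (simp add: fibre_coord_def coord_vec_linear_coord[OF _ bounded_linear_vec_nth])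

lemma slit_chart_apply:
  "p \<in> fst c \<Longrightarrow> snd (slit_chart A c) (p, coord_vec A c p e) = (snd c p, e)"
  by (simp add: slit_chart_def vec_eq_iff fibre_coord_coord_vec)

lemma fst_slit_chart: "fst (slit_chart A c) = slit_dom A c"
  by (simp add: slit_chart_def)

lemma slit_domE:
  assumes "q \<in> slit_dom A c"
  obtains p e where "p \<in> fst c" "e \<noteq> 0" "q = (p, coord_vec A c p e)"
proof -
  obtain p v where q: "q = (p, v)" "p \<in> fst c" "v \<in> tangent_space A p" "v \<noteq> (\<lambda>f. 0)"
    using assms by (auto simp: slit_dom_def)
  then obtain e where "v = coord_vec A c p e" by (auto simp: tangent_space_eq)
  then show ?thesis using that[of p e] q coord_vec_0[OF q(2)] by blast
qed

lemma slit_domI: "p \<in> fst c \<Longrightarrow> e \<noteq> 0 \<Longrightarrow> (p, coord_vec A c p e) \<in> slit_dom A c"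
  using coord_vec_inject[of p e 0] by (auto simp: slit_dom_def tangent_space_eq coord_vec_0)

lemma slit_dom_base: "q \<in> slit_dom A c \<Longrightarrow> fst q \<in> fst c"
  by (auto simp: slit_dom_def)

lemma inj_slit_chart: "inj_on (snd (slit_chart A c)) (slit_dom A c)"
  using inj_chart by (intro inj_onI) (auto elim!: slit_domE simp: slit_chart_apply inj_on_eq_iff)

text \<open>Over a base point common to both charts the two slit domains have the same fibre, namely
  all nonzero tangent vectors. The overlap is therefore a full product with a punctured vector
  space.\<close>

lemma slit_image:
  assumes "d \<in> A"
  shows "snd (slit_chart A c) ` (slit_dom A c \<inter> slit_dom A d) = snd c ` (fst c \<inter> fst d) \<times> (- {0})"
    (is "?L = ?R")
proof
  show "?L \<subseteq> ?R"
  proof (rule image_subsetI)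
    fix q assume q: "q \<in> slit_dom A c \<inter> slit_dom A d"
    then obtain p e where "p \<in> fst c" "e \<noteq> 0" "q = (p, coord_vec A c p e)" using slit_domE by blast
    then show "snd (slit_chart A c) q \<in> ?R" using q by (auto simp: slit_chart_apply slit_dom_def)
  qed
  show "?R \<subseteq> ?L"
  proof
    fix w assume "w \<in> ?R"
    then obtain p e where w: "w = (snd c p, e)" "p \<in> fst c" "p \<in> fst d" "e \<noteq> 0" by auto
    have "(p, coord_vec A c p e) \<in> slit_dom A c \<inter> slit_dom A d"
      using slit_domI[OF w(2,4)] w(3) by (auto simp: slit_dom_def)
    moreover have "w = snd (slit_chart A c) (p, coord_vec A c p e)" using w by (simp add: slit_chart_apply)
    ultimately show "w \<in> ?L" by blast
  qed
qed

lemma slit_Z: "snd (slit_chart A c) ` slit_dom A c = Z \<times> (- {0})"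
  using slit_image[OF chart] by simp

lemma is_chart_slit: "is_chart (slit_chart A c)"
  by (simp add: is_chart_def fst_slit_chart slit_Z inj_slit_chart open_Times open_Z open_Compl)

lemma inv_slit_chart:
  assumes "z \<in> Z" "e \<noteq> 0"
  shows "inv_chart (slit_chart A c) (z, e) = (inv_chart c z, coord_vec A c (inv_chart c z) e)"
  unfolding inv_chart_def fst_slit_chart
  by (rule inv_into_f_eq[OF inj_slit_chart])
    (use assms in \<open>simp_all flip: inv_chart_def add: slit_domI slit_chart_apply inv_chart_in chart_inv\<close>)

lemma slit_transition:
  assumes "d \<in> A" "p \<in> fst c" "p \<in> fst d"
  shows "snd (slit_chart A d) (p, coord_vec A c p e) =
    (snd d p, frechet_derivative (snd d \<circ> inv_chart c) (at (snd c p)) e)"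
proof -
  interpret d: slit A d using atlas assms by unfold_locales
  show ?thesis using coord_vec_transition[OF assms] d.slit_chart_apply[OF assms(3)] by simp
qed

text \<open>Fibre coordinates transform by the Jacobian of the base transition. Its argument is the
  fibre coordinate and varies, so it is expanded in \<open>Basis\<close>; the map is then linear in
  the fibre with coefficients smooth on the base.\<close>

lemma smooth_slit_transition:
  assumes "d \<in> A"
  shows "smooth_on (snd c ` (fst c \<inter> fst d) \<times> (- {0}))
    (snd (slit_chart A d) \<circ> inv_chart (slit_chart A c))"
proof -
  let ?T = "snd c ` (fst c \<inter> fst d)" and ?t = "snd d \<circ> inv_chart c"
  let ?V = "?T \<times> (- {0 :: real^'n})"
  note t = transition[OF assms]
  have V: "open ?V" by (simp add: open_Times t(1) open_Compl)
  have base: "smooth_on ?V (\<lambda>w. h (fst w))" if "smooth_on ?T h" for h :: "real^'n \<Rightarrow> real^'n"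
    by (rule smooth_on_compose[OF V t(1) that smooth_on_linear[OF V bounded_linear_fst]]) auto
  have "smooth_on ?V (\<lambda>w. (snd w \<bullet> b) *\<^sub>R frechet_derivative ?t (at (fst w)) b)" for b
    by (rule smooth_on_bilinear[OF V
          smooth_on_bounded_linear[OF V smooth_on_linear[OF V bounded_linear_snd] bounded_linear_inner_left]
          base[OF smooth_on_frechet_derivative[OF t(2)]] bounded_bilinear_scaleR])
  then have "smooth_on ?V (\<lambda>w. \<Sum>b\<in>Basis. (snd w \<bullet> b) *\<^sub>R frechet_derivative ?t (at (fst w)) b)"
    by (rule smooth_on_sum[OF V])
  then have "smooth_on ?V
      (\<lambda>w. (?t (fst w), \<Sum>b\<in>Basis. (snd w \<bullet> b) *\<^sub>R frechet_derivative ?t (at (fst w)) b))"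
    by (rule smooth_on_Pair[OF V base[OF t(2)]])
  moreover have "(snd (slit_chart A d) \<circ> inv_chart (slit_chart A c)) w =
      (?t (fst w), \<Sum>b\<in>Basis. (snd w \<bullet> b) *\<^sub>R frechet_derivative ?t (at (fst w)) b)" if w: "w \<in> ?V" for w
  proof -
    obtain z e where z: "w = (z, e)" "z \<in> ?T" "e \<noteq> 0" using w by auto
    let ?p = "inv_chart c z"
    have p: "z \<in> Z" "?p \<in> fst c" "?p \<in> fst d" using z by auto
    have "linear (frechet_derivative ?t (at z))"
      using smooth_on_has_derivative[OF t(1,2) z(2)] has_derivative_linear by blast
    then have "frechet_derivative ?t (at z) (\<Sum>b\<in>Basis. (e \<bullet> b) *\<^sub>R b) =
        (\<Sum>b\<in>Basis. (e \<bullet> b) *\<^sub>R frechet_derivative ?t (at z) b)"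
      by (simp add: linear_sum linear_cmul)
    then show ?thesis
      using slit_transition[OF assms p(2,3)] z p by (simp add: inv_slit_chart chart_inv euclidean_representation)
  qed
  ultimately show ?thesis by (rule smooth_on_eqI[OF V])
qed

lemma compatible_slit:
  assumes "d \<in> A"
  shows "compatible (slit_chart A c) (slit_chart A d)"
proof -
  interpret d: slit A d using atlas assms by unfold_locales
  show ?thesis
    using smooth_slit_transition[OF assms] d.smooth_slit_transition[OF chart] slit_image[OF assms]
      d.slit_image[OF chart] transition(1)[OF assms] d.transition(1)[OF chart]
    by (simp add: compatible_def fst_slit_chart d.fst_slit_chart Int_commute open_Times open_Compl)
qed

end

lemma smooth_slit_atlas:
  fixes A :: "('p, real^'n::finite) chart set"
  assumes "smooth_atlas A"
  shows "smooth_atlas (slit_atlas A)"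
  unfolding smooth_atlas_def slit_atlas_def
proof (intro conjI ballI; clarsimp)
  fix c assume "c \<in> A"
  then interpret slit A c using assms by unfold_locales
  show "is_chart (slit_chart A c)" by (rule is_chart_slit)
  show "compatible (slit_chart A c) (slit_chart A d)" if "d \<in> A" for d by (rule compatible_slit[OF that])
qed

text \<open>All chart calculus becomes available on the slit bundle under the prefix
  \<open>T\<close>, side by side with the unprefixed calculus on the base.\<close>

sublocale slit \<subseteq> T: atlas_chart "slit_atlas A" "slit_chart A c"
  using smooth_slit_atlas[OF atlas] chart by unfold_locales (simp_all add: slit_atlas_def)

context slit
begin

text \<open>In the induced coordinates, pulling back to the bundle is composition with the linear
  projection \<open>fst\<close>.\<close>

lemma smooth_at_lift:
  assumes q: "q \<in> slit_dom A c" and f: "smooth_at A (fst q) f"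
  shows "smooth_at (slit_atlas A) q (\<lambda>r. f (fst r))"
    and "coord_vec (slit_atlas A) (slit_chart A c) q (e, e') (\<lambda>r. f (fst r)) = coord_vec A c (fst q) e f"
proof -
  obtain p u where qp: "p \<in> fst c" "u \<noteq> 0" "q = (p, coord_vec A c p u)" using q slit_domE by blast
  obtain S where S: "open S" "snd c p \<in> S" "S \<subseteq> Z" "smooth_on S (f \<circ> inv_chart c)"
    using f smooth_at_iff[OF qp(1)] qp(3) by auto
  let ?V = "S \<times> (- {0 :: real^'n})"
  have V: "open ?V" by (simp add: open_Times S open_Compl)
  have eq: "((\<lambda>r. f (fst r)) \<circ> inv_chart (slit_chart A c)) w = (f \<circ> inv_chart c) (fst w)" if "w \<in> ?V" for w
    using that S(3) by (cases w) (simp add: inv_slit_chart subset_iff)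
  have qV: "snd (slit_chart A c) q \<in> ?V" using S qp by (simp add: slit_chart_apply)
  have "smooth_on ?V (\<lambda>w. (f \<circ> inv_chart c) (fst w))"
    by (rule smooth_on_compose[OF V S(1,4) smooth_on_linear[OF V bounded_linear_fst]]) auto
  then have "smooth_on ?V ((\<lambda>r. f (fst r)) \<circ> inv_chart (slit_chart A c))"
    by (rule smooth_on_eqI[OF V]) (rule eq)
  moreover have "?V \<subseteq> snd (slit_chart A c) ` fst (slit_chart A c)"
    using S(3) by (auto simp: fst_slit_chart slit_Z)
  ultimately show sm: "smooth_at (slit_atlas A) q (\<lambda>r. f (fst r))"
    unfolding T.smooth_at_iff[of q, unfolded fst_slit_chart, OF q] using V qV
    by (intro exI[of _ ?V]) (simp add: fst_slit_chart)
  have "((\<lambda>w. (f \<circ> inv_chart c) (fst w)) has_derivative (\<lambda>w. coord_vec A c p (fst w) f))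
      (at (snd (slit_chart A c) q))"
    using has_derivative_compose[OF bounded_linear_imp_has_derivative[OF bounded_linear_fst],
      of "f \<circ> inv_chart c" "\<lambda>e. coord_vec A c p e f" "snd (slit_chart A c) q"]
      smooth_at_has_derivative[OF qp(1)] f qp by (simp add: slit_chart_apply comp_def)
  then have "((\<lambda>r. f (fst r)) \<circ> inv_chart (slit_chart A c) has_derivative (\<lambda>w. coord_vec A c p (fst w) f))
      (at (snd (slit_chart A c) q))"
    by (rule has_derivative_transform_within_open[OF _ V qV]) (rule eq[symmetric])
  then show "coord_vec (slit_atlas A) (slit_chart A c) q (e, e') (\<lambda>r. f (fst r)) = coord_vec A c (fst q) e f"
    using T.coord_vec_eqI[OF _ sm] q qp by (simp add: fst_slit_chart)
qed

lemma smooth_at_fibre_coord: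
  assumes "q \<in> slit_dom A c"
  shows "smooth_at (slit_atlas A) q (\<lambda>r. fibre_coord c r m)"
    and "coord_vec (slit_atlas A) (slit_chart A c) q (e, e') (\<lambda>r. fibre_coord c r m) = e' $ m"
proof -
  have L: "bounded_linear (\<lambda>w :: (real^'n) \<times> (real^'n). snd w $ m)"
    by (rule bounded_linear_compose[OF bounded_linear_vec_nth bounded_linear_snd])
  have q: "q \<in> fst (slit_chart A c)" using assms fst_slit_chart by simp
  have eq: "(\<lambda>r. fibre_coord c r m) = (\<lambda>r. snd (snd (slit_chart A c) r) $ m)"
    by (simp add: slit_chart_def)
  show "smooth_at (slit_atlas A) q (\<lambda>r. fibre_coord c r m)"
    unfolding eq by (rule T.smooth_at_linear_coord[OF q L])
  show "coord_vec (slit_atlas A) (slit_chart A c) q (e, e') (\<lambda>r. fibre_coord c r m) = e' $ m"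
    unfolding eq using T.coord_vec_linear_coord[OF q L] by simp
qed

lemma coord_vec_base_coord:
  assumes "q \<in> slit_dom A c"
  shows "coord_vec (slit_atlas A) (slit_chart A c) q (e, e') (\<lambda>r. snd c (fst r) $ m) = e $ m"
  using smooth_at_lift(2)[OF assms smooth_at_linear_coord[OF slit_dom_base[OF assms] bounded_linear_vec_nth], of e e' m]
    coord_vec_linear_coord[OF slit_dom_base[OF assms] bounded_linear_vec_nth]
  by simp

lemma slit_tangentE:
  assumes "q \<in> slit_dom A c" "v \<in> tangent_space (slit_atlas A) q"
  shows "v = coord_vec (slit_atlas A) (slit_chart A c) q
    (\<chi> m. v (\<lambda>r. snd c (fst r) $ m), \<chi> m. v (\<lambda>r. fibre_coord c r m))"
proof -
  obtain e e' where v: "v = coord_vec (slit_atlas A) (slit_chart A c) q (e, e')"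
    using assms T.tangent_space_eq[of q] by (auto simp: fst_slit_chart)
  show ?thesis
    unfolding v using assms(1) by (simp add: smooth_at_fibre_coord coord_vec_base_coord)
qed

end

section \<open>Connections in a chart\<close>

text \<open>The tangent spaces carry just a symmetric bilinear form because the locale also has to
  cover the indefinite \<open>G\<close>. Nondegeneracy enters separately, through the components of
  \<open>g\<close>.\<close>

locale lc_chart = atlas_chart A c for A :: "('p, 'e::euclidean_space) chart set" and c +
  fixes g :: "'p \<Rightarrow> 'p tvec \<Rightarrow> 'p tvec \<Rightarrow> real" and D :: "'p vfield \<Rightarrow> 'p vfield \<Rightarrow> 'p vfield"
  assumes lc: "levi_civita A g D"
    and bilinear: "\<And>p. p \<in> fst c \<Longrightarrow> symmetric_bilinear_on (tangent_space A p) (g p)"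
begin

text \<open>Clauses of \<open>connection\<close> instantiated at the open set \<open>fst c\<close>.
  \<open>D_local\<close> is the one that lets a field be replaced by an expression equal to it over
  the chart domain only.\<close>

lemma
  assumes "X \<in> VF" "Y \<in> VF"
  shows D_VF: "D X Y \<in> VF"
    and D_local: "X' \<in> VF \<Longrightarrow> Y' \<in> VF \<Longrightarrow> (\<And>p. p \<in> fst c \<Longrightarrow> X p = X' p) \<Longrightarrow>
      (\<And>p. p \<in> fst c \<Longrightarrow> Y p = Y' p) \<Longrightarrow> p \<in> fst c \<Longrightarrow> D X Y p = D X' Y' p"
    and D_add: "Y' \<in> VF \<Longrightarrow> p \<in> fst c \<Longrightarrow>
      D X (\<lambda>q f. Y q f + Y' q f) p = (\<lambda>f. D X Y p f + D X Y' p f)"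
    and D_scale_left: "smooth_fun A (fst c) h \<Longrightarrow> p \<in> fst c \<Longrightarrow>
      D (\<lambda>q f. h q * X q f) Y p = (\<lambda>f. h p * D X Y p f)"
    and D_leibniz: "smooth_fun A (fst c) h \<Longrightarrow> p \<in> fst c \<Longrightarrow>
      D X (\<lambda>q f. h q * Y q f) p = (\<lambda>f. X p h * Y p f + h p * D X Y p f)"
proof -
  have "connection A D" using lc by (simp add: levi_civita_def)
  note con = this[unfolded connection_def, rule_format, OF atlas_open_chart]
  show "D X Y \<in> VF" using con assms by blast
  show "D X Y p = D X' Y' p" if "X' \<in> VF" "Y' \<in> VF" "\<And>p. p \<in> fst c \<Longrightarrow> X p = X' p"
    "\<And>p. p \<in> fst c \<Longrightarrow> Y p = Y' p" "p \<in> fst c"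
    using con[THEN conjunct2, THEN conjunct1] assms that by blast
  show "D X (\<lambda>q f. Y q f + Y' q f) p = (\<lambda>f. D X Y p f + D X Y' p f)" if "Y' \<in> VF" "p \<in> fst c"
    using con[THEN conjunct2, THEN conjunct2, THEN conjunct2, THEN conjunct1] assms that by blast
  show "D (\<lambda>q f. h q * X q f) Y p = (\<lambda>f. h p * D X Y p f)"
    "D X (\<lambda>q f. h q * Y q f) p = (\<lambda>f. X p h * Y p f + h p * D X Y p f)"
    if "smooth_fun A (fst c) h" "p \<in> fst c"
    using con[THEN conjunct2, THEN conjunct2, THEN conjunct2, THEN conjunct2] assms that by blast+
qed

lemma zero_VF: "(\<lambda>p f. 0) \<in> VF"
  using vector_field_sum[of "{}"] by simp

lemma smooth_fun_const: "smooth_fun A (fst c) (\<lambda>p. a)"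
  by (simp add: smooth_fun_def smooth_at_const)

text \<open>The zero field is the constant 0 times itself, so the Leibniz rule and homogeneity in
  the first argument apply with \<open>h\<close> constantly 0.\<close>

lemma D_zero:
  assumes "X \<in> VF" "p \<in> fst c"
  shows "D X (\<lambda>p f. 0) p = (\<lambda>f. 0)" and "D (\<lambda>p f. 0) X p = (\<lambda>f. 0)"
  using D_leibniz[OF assms(1) zero_VF smooth_fun_const assms(2), of 0]
    D_scale_left[OF zero_VF assms(1) smooth_fun_const assms(2), of 0]
    tangent_const[OF assms(2) vector_field_tangent[OF assms]] by simp_all

lemma D_sum:
  assumes "X \<in> VF" "finite I" "\<And>i. i \<in> I \<Longrightarrow> Y i \<in> VF" "\<And>i. i \<in> I \<Longrightarrow> smooth_fun A (fst c) (h i)"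
    and "p \<in> fst c"
  shows "D X (\<lambda>q f. \<Sum>i\<in>I. h i q * Y i q f) p = (\<lambda>f. \<Sum>i\<in>I. X p (h i) * Y i p f + h i p * D X (Y i) p f)"
  using assms(2-4)
proof (induction I rule: finite_induct)
  case empty
  then show ?case by (simp add: D_zero assms)
next
  case (insert i I)
  have "(\<lambda>q f. h i q * Y i q f) \<in> VF" "(\<lambda>q f. \<Sum>i\<in>I. h i q * Y i q f) \<in> VF"
    using insert.prems by (auto intro!: vector_field_scale vector_field_sum)
  from D_add[OF assms(1) this assms(5)] show ?case
    using insert D_leibniz[OF assms(1) insert.prems(1) insert.prems(2) assms(5), of i i] by simp
qed

lemma torsion:
  assumes "X \<in> VF" "Y \<in> VF" "p \<in> fst c"
  shows "lie_bracket A X Y p = (\<lambda>f. D X Y p f - D Y X p f)"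
proof -
  have "torsion_free A D" using lc by (simp add: levi_civita_def)
  from this[unfolded torsion_free_def, rule_format, OF atlas_open_chart assms] show ?thesis by simp
qed

text \<open>By definition \<open>lie_bracket\<close> is merely an operator on functions;
  torsion-freeness exhibits it as a difference of two tangent vectors.\<close>

lemma lie_bracket_tangent:
  assumes "X \<in> VF" "Y \<in> VF" "p \<in> fst c"
  shows "lie_bracket A X Y p \<in> tangent_space A p"
  using tangent_combine[OF assms(3) vector_field_tangent[OF D_VF[OF assms(1,2)] assms(3)]
      vector_field_tangent[OF D_VF[OF assms(2,1)] assms(3)], of 1 "-1"]
  by (simp add: torsion[OF assms])

lemma metric:
  assumes "X \<in> VF" "Y \<in> VF" "V \<in> VF" "p \<in> fst c"
  shows "X p (\<lambda>q. g q (Y q) (V q)) = g p (D X Y p) (V p) + g p (Y p) (D X V p)"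
proof -
  have "metric_compatible A g D" using lc by (simp add: levi_civita_def)
  from this[unfolded metric_compatible_def, rule_format, OF atlas_open_chart assms] show ?thesis .
qed

lemma g_sym: "p \<in> fst c \<Longrightarrow> u \<in> tangent_space A p \<Longrightarrow> v \<in> tangent_space A p \<Longrightarrow> g p u v = g p v u"
  using bilinear unfolding symmetric_bilinear_on_def by blast

lemma g_combine:
  "p \<in> fst c \<Longrightarrow> u \<in> tangent_space A p \<Longrightarrow> v \<in> tangent_space A p \<Longrightarrow> w \<in> tangent_space A p \<Longrightarrow>
    g p (\<lambda>f. a * u f + b * v f) w = a * g p u w + b * g p v w"
  using bilinear unfolding symmetric_bilinear_on_def by blast

lemma g_sum:
  assumes "p \<in> fst c" "finite I" "\<And>i. i \<in> I \<Longrightarrow> v i \<in> tangent_space A p" "w \<in> tangent_space A p"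
  shows "g p (\<lambda>f. \<Sum>i\<in>I. a i * v i f) w = (\<Sum>i\<in>I. a i * g p (v i) w)"
  using assms(2,3)
proof (induction I rule: finite_induct)
  case empty
  then show ?case using g_combine[OF assms(1,4,4,4), of 0 0] by simp
next
  case (insert i I)
  have "g p (\<lambda>f. a i * v i f + 1 * (\<Sum>i\<in>I. a i * v i f)) w = a i * g p (v i) w + 1 * g p (\<lambda>f. \<Sum>i\<in>I. a i * v i f) w"
    by (rule g_combine[OF assms(1) _ tangent_sum[OF assms(1)] assms(4)]) (use insert.prems in auto)
  then show ?case using insert by simp
qed

lemma koszul:
  assumes X: "X \<in> VF" and Y: "Y \<in> VF" and V: "V \<in> VF" and p: "p \<in> fst c"
  shows "2 * g p (D X Y p) (V p) =
    X p (\<lambda>q. g q (Y q) (V q)) + Y p (\<lambda>q. g q (X q) (V q)) - V p (\<lambda>q. g q (X q) (Y q))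
    + g p (lie_bracket A X Y p) (V p) - g p (lie_bracket A X V p) (Y p) - g p (lie_bracket A Y V p) (X p)"
proof -
  have brk: "g p (lie_bracket A U V' p) (W p) = g p (D U V' p) (W p) - g p (D V' U p) (W p)"
    if "U \<in> VF" "V' \<in> VF" "W \<in> VF" for U V' W
    using g_combine[OF p vector_field_tangent[OF D_VF[OF that(1,2)] p]
        vector_field_tangent[OF D_VF[OF that(2,1)] p] vector_field_tangent[OF that(3) p], of 1 "-1"]
    by (simp add: torsion[OF that(1,2) p])
  have sym: "g p (U p) (D V' W p) = g p (D V' W p) (U p)" if "U \<in> VF" "V' \<in> VF" "W \<in> VF" for U V' W
    by (rule g_sym[OF p]) (use that p in \<open>auto intro!: vector_field_tangent D_VF\<close>)
  \<comment> \<open>Twelve terms arise. By symmetry of \<open>g\<close> five pairs cancel, and two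
    copies of \<open>g p (D X Y p) (V p)\<close> remain.\<close>
  show ?thesis
    unfolding metric[OF X Y V p] metric[OF Y X V p] metric[OF V X Y p]
      brk[OF X Y V] brk[OF X V Y] brk[OF Y V X]
    by (simp add: sym X Y V)
qed

end

section \<open>Coordinate components of a Levi-Civita connection\<close>

text \<open>The Bianchi sum over \<open>j\<close>, \<open>i\<close>, \<open>k\<close> with
  \<open>a\<close> held last gives \<open>K j i a k - K k i a j = - K k j a i\<close>. The left side
  is thus \<open>- 2 * K k j a i\<close>, and antisymmetry followed by pair symmetry turns this into
  \<open>2 * K a i j k\<close>.\<close>

lemma curvature_index_identity:
  fixes K :: "'i \<Rightarrow> 'i \<Rightarrow> 'i \<Rightarrow> 'i \<Rightarrow> real"
  assumes anti1: "\<And>a b d e. K a b d e = - K b a d e" and anti2: "\<And>a b d e. K a b d e = - K a b e d"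
    and bianchi: "\<And>a b d e. K a b d e + K b d a e + K d a b e = 0"
  shows "K j i a k - K k i a j - K k j a i = 2 * K a i j k"
proof -
  \<comment> \<open>The classical argument: four Bianchi sums, each holding a different index last,
    combined with both antisymmetries.\<close>
  have pair: "K a b d e = K d e a b" for a b d e
    using bianchi[of a b d e] bianchi[of b d e a] bianchi[of d e a b] bianchi[of e a b d]
      anti1[of a b] anti1[of b d] anti1[of d a] anti1[of d e] anti1[of e b] anti1[of e a] anti1[of b e] anti1[of a d]
      anti2[of a b] anti2[of b d] anti2[of d a] anti2[of d e] anti2[of e b] anti2[of e a] anti2[of b e] anti2[of a d]
    by smt
  show ?thesis
    using pair[of a i j k] bianchi[of j i k a] anti2[of j i a k] anti2[of k i a j] anti2[of k j a i]
      anti1[of k i j a] anti1[of k j i a] anti2[of j k a i] bianchi[of k i j a]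
    by (smt (verit))
qed

lemma sum_kron [simp]:
  fixes a :: "'i::finite \<Rightarrow> real"
  shows "(\<Sum>m\<in>UNIV. a m * kron m h) = a h" "(\<Sum>m\<in>UNIV. a m * kron h m) = a h"
    "(\<Sum>m\<in>UNIV. kron m h * a m) = a h" "(\<Sum>m\<in>UNIV. kron h m * a m) = a h"
  by (simp_all add: kron_def if_distrib[of "\<lambda>x. _ * x"] if_distrib[of "\<lambda>x. x * _"] cong: if_cong)

locale riem_chart = slit A c for A :: "('p, real^'n::finite) chart set" and c +
  fixes g :: "'p \<Rightarrow> 'p tvec \<Rightarrow> 'p tvec \<Rightarrow> real" and D :: "'p vfield \<Rightarrow> 'p vfield \<Rightarrow> 'p vfield"
  assumes riem: "riemannian_metric A g" and lev: "levi_civita A g D"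

sublocale riem_chart \<subseteq> lc_chart A c g D
proof
  show "levi_civita A g D" by (rule lev)
  show "symmetric_bilinear_on (tangent_space A p) (g p)" if "p \<in> fst c" for p
    using riem in_points[OF that] by (auto simp: riemannian_metric_def)
qed

context riem_chart
begin

abbreviation "dx \<equiv> coord_frame A c"
abbreviation "gc \<equiv> metric_comp A g c"
abbreviation "Gam \<equiv> christoffel A D c"
abbreviation "K \<equiv> curv_comp A D c"

section \<open>The metric in coordinates\<close>

lemma coord_frame_VF: "dx i \<in> VF"
  using coord_vec_field by (simp add: coord_frame_def)

lemma coord_frame_tangent: "p \<in> fst c \<Longrightarrow> dx i p \<in> tangent_space A p"
  using vector_field_tangent[OF coord_frame_VF] .

lemma smooth_metric_comp: "smooth_fun A (fst c) (\<lambda>p. gc p i j)"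
  using riem atlas_open_chart coord_frame_VF unfolding riemannian_metric_def metric_comp_def by blast

lemma metric_comp_sym: "p \<in> fst c \<Longrightarrow> gc p i j = gc p j i"
  unfolding metric_comp_def by (rule g_sym) (simp_all add: coord_frame_tangent)

lemma coord_vec_expand: "p \<in> fst c \<Longrightarrow> coord_vec A c p e = (\<lambda>f. \<Sum>i\<in>UNIV. e $ i * dx i p f)"
  using coord_vec_sum[of p "\<lambda>i. e $ i" "\<lambda>i. axis i 1" UNIV]
  by (simp add: coord_frame_def basis_expansion flip: scalar_mult_eq_scaleR)

lemma metric_comp_pos:
  assumes p: "p \<in> fst c" and e: "e \<noteq> 0"
  shows "(\<Sum>i\<in>UNIV. \<Sum>j\<in>UNIV. gc p i j * e $ i * e $ j) > 0"
proof -
  let ?v = "coord_vec A c p e"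
  have v: "?v \<in> tangent_space A p" by (rule coord_vec_in_tangent[OF p])
  have "?v \<noteq> (\<lambda>f. 0)" using coord_vec_inject[OF p, of e 0] e coord_vec_0[OF p] by simp
  then have "0 < g p ?v ?v" using riem v in_points[OF p] unfolding riemannian_metric_def by blast
  also have "g p ?v ?v = (\<Sum>i\<in>UNIV. e $ i * g p (dx i p) ?v)"
    by (subst (1) coord_vec_expand[OF p]) (simp add: g_sum[OF p _ _ v] coord_frame_tangent[OF p])
  also have "\<dots> = (\<Sum>i\<in>UNIV. e $ i * (\<Sum>j\<in>UNIV. e $ j * gc p j i))"
  proof -
    have "g p (dx i p) ?v = (\<Sum>j\<in>UNIV. e $ j * gc p j i)" for i
      unfolding metric_comp_def g_sym[OF p coord_frame_tangent[OF p] v]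
      by (subst coord_vec_expand[OF p]) (simp add: g_sum[OF p] coord_frame_tangent[OF p])
    then show ?thesis by simp
  qed
  also have "\<dots> = (\<Sum>i\<in>UNIV. \<Sum>j\<in>UNIV. gc p i j * e $ i * e $ j)"
    by (simp add: sum_distrib_left metric_comp_sym[OF p] algebra_simps)
  finally show ?thesis .
qed

text \<open>Contracting the difference of the two sides with \<open>u - w\<close> itself gives the
  squared length of that vector, so positivity forces it to vanish.\<close>

lemma metric_comp_nondegenerate:
  assumes p: "p \<in> fst c" and "\<And>k. (\<Sum>m\<in>UNIV. u m * gc p m k) = (\<Sum>m\<in>UNIV. w m * gc p m k)"
  shows "u m = w m"
proof (rule ccontr)
  assume "u m \<noteq> w m"
  define e :: "real^'n" where "e = (\<chi> m. u m - w m)"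
  have "e \<noteq> 0" using \<open>u m \<noteq> w m\<close> by (auto simp: e_def vec_eq_iff)
  then have "(\<Sum>k\<in>UNIV. \<Sum>m\<in>UNIV. gc p m k * e $ m * e $ k) > 0"
    using metric_comp_pos[OF p] by (subst sum.swap) simp
  moreover have "(\<Sum>m\<in>UNIV. gc p m k * e $ m * e $ k) = 0" for k
  proof -
    have "(\<Sum>m\<in>UNIV. gc p m k * e $ m * e $ k) =
        ((\<Sum>m\<in>UNIV. u m * gc p m k) - (\<Sum>m\<in>UNIV. w m * gc p m k)) * e $ k"
      unfolding sum_subtractf[symmetric] sum_distrib_right
      by (intro sum.cong) (simp_all add: e_def algebra_simps)
    then show ?thesis using assms(2) by simp
  qed
  ultimately show False by simp
qed

lemma tangent_expand:
  assumes "p \<in> fst c" "v \<in> tangent_space A p"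
  shows "v = (\<lambda>f. \<Sum>m\<in>UNIV. v (\<lambda>r. snd c r $ m) * dx m p f)"
proof -
  obtain e where v: "v = coord_vec A c p e" using assms tangent_space_eq by auto
  show ?thesis
    unfolding v coord_vec_linear_coord[OF assms(1) bounded_linear_vec_nth]
    by (rule coord_vec_expand[OF assms(1)])
qed

lemma coord_frame_coord: "p \<in> fst c \<Longrightarrow> dx i p (\<lambda>r. snd c r $ m) = kron i m"
  by (simp add: coord_frame_def coord_vec_linear_coord[OF _ bounded_linear_vec_nth] kron_def axis_def eq_commute)

text \<open>Evaluation on the coordinate functions supplies the existence and uniqueness behind the
  description operator in \<open>frame_comp\<close>.\<close>

lemma frame_comp_coord:
  assumes "p \<in> fst c" "v \<in> tangent_space A p"
  shows "frame_comp dx p v m = v (\<lambda>r. snd c r $ m)"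
proof -
  have "frame_comp dx p v = (\<lambda>m. v (\<lambda>r. snd c r $ m))"
    unfolding frame_comp_def
  proof (rule the_equality)
    show "v = (\<lambda>f. \<Sum>m\<in>UNIV. v (\<lambda>r. snd c r $ m) * dx m p f)" by (rule tangent_expand[OF assms])
    show "a = (\<lambda>m. v (\<lambda>r. snd c r $ m))" if "v = (\<lambda>f. \<Sum>m\<in>UNIV. a m * dx m p f)" for a
      by (simp add: that coord_frame_coord[OF assms(1)])
  qed
  then show ?thesis by simp
qed

section \<open>Christoffel symbols\<close>

lemma christoffel_eq: "p \<in> fst c \<Longrightarrow> Gam p a i m = D (dx i) (dx a) p (\<lambda>r. snd c r $ m)"
  unfolding christoffel_def conn_coeff_def
  by (rule frame_comp_coord[OF _ vector_field_tangent[OF D_VF[OF coord_frame_VF coord_frame_VF]]])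

text \<open>Each symbol is the value of a smooth vector field on a coordinate function, which the
  description operator in its definition hides.\<close>

lemma smooth_christoffel: "smooth_fun A (fst c) (\<lambda>p. Gam p a i m)"
  unfolding smooth_fun_def
proof
  fix p assume p: "p \<in> fst c"
  have "smooth_at A p (\<lambda>r. D (dx i) (dx a) r (\<lambda>r. snd c r $ m))"
    by (rule vector_field_smooth[OF D_VF[OF coord_frame_VF coord_frame_VF] p
          smooth_at_linear_coord[OF p bounded_linear_vec_nth]])
  then show "smooth_at A p (\<lambda>p. Gam p a i m)"
    by (subst smooth_at_cong[OF p christoffel_eq])
qed

lemma D_coord_frame: "p \<in> fst c \<Longrightarrow> D (dx i) (dx a) p = (\<lambda>f. \<Sum>m\<in>UNIV. Gam p a i m * dx m p f)"
  using tangent_expand[OF _ vector_field_tangent[OF D_VF[OF coord_frame_VF coord_frame_VF]]]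
  by (simp add: christoffel_eq)

text \<open>
  Torsion-freeness makes the bracket a tangent vector, so that it is determined by its values on
  the coordinate functions; no symmetry of second derivatives is needed.
\<close>

lemma lie_bracket_coord_frame:
  assumes p: "p \<in> fst c"
  shows "lie_bracket A (dx i) (dx j) p = (\<lambda>f. 0)"
proof -
  let ?b = "lie_bracket A (dx i) (dx j) p"
  have "?b (\<lambda>r. snd c r $ m) = 0" for m
  proof -
    have sm: "smooth_at A p (\<lambda>r. snd c r $ m)"
      by (rule smooth_at_linear_coord[OF p bounded_linear_vec_nth])
    have "dx i p (\<lambda>q. dx j q (\<lambda>r. snd c r $ m)) = 0" for i j
      using tangent_cong[OF p coord_frame_tangent[OF p] coord_frame_coord]
        tangent_const[OF p coord_frame_tangent[OF p]] by simp
    then show ?thesis by (simp add: lie_bracket_def sm)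
  qed
  then show ?thesis
    by (subst tangent_expand[OF p lie_bracket_tangent[OF coord_frame_VF coord_frame_VF p]]) simp
qed

lemma christoffel_sym: "p \<in> fst c \<Longrightarrow> Gam p a i m = Gam p i a m"
  using torsion[OF coord_frame_VF coord_frame_VF, of p i a] lie_bracket_coord_frame[of p i a]
  by (simp add: christoffel_eq fun_eq_iff)

lemma g_D_coord_frame:
  "p \<in> fst c \<Longrightarrow> g p (D (dx k) (dx i) p) (dx j p) = (\<Sum>m\<in>UNIV. Gam p i k m * gc p m j)"
  by (simp add: D_coord_frame g_sum coord_frame_tangent metric_comp_def)

lemma deriv_metric_comp:
  assumes p: "p \<in> fst c"
  shows "dx k p (\<lambda>r. gc r i j) = (\<Sum>m\<in>UNIV. Gam p i k m * gc p m j) + (\<Sum>m\<in>UNIV. Gam p j k m * gc p m i)"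
  unfolding metric_comp_def metric[OF coord_frame_VF coord_frame_VF coord_frame_VF p]
  using g_D_coord_frame[OF p, unfolded metric_comp_def]
    g_sym[OF p coord_frame_tangent[OF p] vector_field_tangent[OF D_VF[OF coord_frame_VF coord_frame_VF] p]]
  by simp

section \<open>The curvature in coordinates and its symmetries\<close>

lemma DD_coord_frame:
  assumes p: "p \<in> fst c"
  shows "D (dx j) (D (dx i) (dx a)) p =
    (\<lambda>f. \<Sum>m\<in>UNIV. dx j p (\<lambda>r. Gam r a i m) * dx m p f + Gam p a i m * D (dx j) (dx m) p f)"
proof -
  \<comment> \<open>The Christoffel expansion is known over the chart domain only, hence the appeal
    to locality before the Leibniz rule.\<close>
  have "D (dx j) (D (dx i) (dx a)) p = D (dx j) (\<lambda>q f. \<Sum>m\<in>UNIV. Gam q a i m * dx m q f) p"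
    by (rule D_local[OF coord_frame_VF D_VF[OF coord_frame_VF coord_frame_VF] coord_frame_VF])
      (auto intro!: vector_field_sum coord_frame_VF smooth_christoffel p D_coord_frame)
  also have "\<dots> = (\<lambda>f. \<Sum>m\<in>UNIV. dx j p (\<lambda>r. Gam r a i m) * dx m p f + Gam p a i m * D (dx j) (dx m) p f)"
    by (rule D_sum[OF coord_frame_VF]) (auto intro: coord_frame_VF smooth_christoffel p)
  finally show ?thesis .
qed

text \<open>The bracket of coordinate fields is known to vanish over the chart domain only, so
  locality exchanges it for the zero field.\<close>

lemma curvature_coord_frame:
  assumes p: "p \<in> fst c"
  shows "curvature A D (dx j) (dx i) (dx a) p =
    (\<lambda>f. D (dx j) (D (dx i) (dx a)) p f - D (dx i) (D (dx j) (dx a)) p f)"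
proof -
  have "lie_bracket A (dx j) (dx i) \<in> VF"
    by (rule vector_field_cong[OF zero_VF]) (simp add: lie_bracket_coord_frame)
  then have "D (lie_bracket A (dx j) (dx i)) (dx a) p = D (\<lambda>p f. 0) (dx a) p"
    by (rule D_local) (simp_all add: coord_frame_VF zero_VF lie_bracket_coord_frame p)
  then show ?thesis by (simp add: curvature_def D_zero(2)[OF coord_frame_VF p])
qed

lemma curvature_tangent:
  assumes p: "p \<in> fst c"
  shows "curvature A D (dx j) (dx i) (dx a) p \<in> tangent_space A p"
proof -
  have "D (dx j) (D (dx i) (dx a)) p \<in> tangent_space A p" for i j
    by (intro vector_field_tangent[OF _ p] D_VF coord_frame_VF)
  from tangent_combine[OF p this this, of 1 j i "-1" i j] show ?thesis
    by (simp add: curvature_coord_frame[OF p])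
qed

lemma curv_comp_eq:
  assumes p: "p \<in> fst c"
  shows "K p j i a m = dx j p (\<lambda>r. Gam r a i m) - dx i p (\<lambda>r. Gam r a j m)
    + (\<Sum>l\<in>UNIV. Gam p a i l * Gam p l j m) - (\<Sum>l\<in>UNIV. Gam p a j l * Gam p l i m)"
proof -
  have "D (dx j) (D (dx i) (dx a)) p (\<lambda>r. snd c r $ m) =
      dx j p (\<lambda>r. Gam r a i m) + (\<Sum>l\<in>UNIV. Gam p a i l * Gam p l j m)" for i j
    by (simp add: DD_coord_frame[OF p] coord_frame_coord[OF p] sum.distrib flip: christoffel_eq[OF p])
  then show ?thesis
    by (simp add: curv_comp_def frame_comp_coord[OF p curvature_tangent[OF p]])
      (simp add: curvature_coord_frame[OF p])
qed

text \<open>The covariant curvature tensor g(R(dx j, dx i) dx a, dx k).\<close>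

abbreviation "Klow p j i a k \<equiv> \<Sum>m\<in>UNIV. K p j i a m * gc p m k"

lemma curv_low_eq:
  assumes p: "p \<in> fst c"
  shows "Klow p j i a k =
    g p (D (dx j) (D (dx i) (dx a)) p) (dx k p) - g p (D (dx i) (D (dx j) (dx a)) p) (dx k p)"
proof -
  note t = curvature_tangent[OF p]
  have "Klow p j i a k = g p (\<lambda>f. \<Sum>m\<in>UNIV. K p j i a m * dx m p f) (dx k p)"
    by (simp add: g_sum[OF p] coord_frame_tangent[OF p] metric_comp_def)
  also have "\<dots> = g p (curvature A D (dx j) (dx i) (dx a) p) (dx k p)"
    using tangent_expand[OF p t] by (simp add: curv_comp_def frame_comp_coord[OF p t])
  also have "\<dots> = g p (D (dx j) (D (dx i) (dx a)) p) (dx k p) - g p (D (dx i) (D (dx j) (dx a)) p) (dx k p)"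
  proof -
    have T: "D (dx j) (D (dx i) (dx a)) p \<in> tangent_space A p" for i j
      by (intro vector_field_tangent[OF _ p] D_VF coord_frame_VF)
    show ?thesis
      using g_combine[OF p T T coord_frame_tangent[OF p], of 1 j i "-1" i j]
      by (simp add: curvature_coord_frame[OF p])
  qed
  finally show ?thesis .
qed

lemma curv_low_anti1: "p \<in> fst c \<Longrightarrow> Klow p j i a k = - Klow p i j a k"
  by (simp add: curv_low_eq)

lemma curv_bianchi: "p \<in> fst c \<Longrightarrow> K p j i a m + K p i a j m + K p a j i m = 0"
proof -
  assume p: "p \<in> fst c"
  \<comment> \<open>Symmetry of the Christoffel symbols is used as an identity of functions over the
    chart domain, so that their derivatives cancel too.\<close>
  have "dx j p (\<lambda>r. Gam r a i m) = dx j p (\<lambda>r. Gam r i a m)" for j a i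
    by (rule tangent_cong[OF p coord_frame_tangent[OF p] christoffel_sym])
  then show ?thesis
    unfolding curv_comp_eq[OF p] using christoffel_sym[OF p] by simp
qed

lemma curv_low_bianchi:
  assumes "p \<in> fst c"
  shows "Klow p j i a k + Klow p i a j k + Klow p a j i k = 0"
proof -
  have "Klow p j i a k + Klow p i a j k + Klow p a j i k =
      (\<Sum>m\<in>UNIV. (K p j i a m + K p i a j m + K p a j i m) * gc p m k)"
    by (simp add: sum.distrib distrib_right)
  then show ?thesis by (simp add: curv_bianchi[OF assms])
qed

text \<open>Metric compatibility applied to the two mixed second derivatives of \<open>g(dx a, dx k)\<close>, which agree.\<close>

lemma curv_low_anti2:
  assumes p: "p \<in> fst c"
  shows "Klow p j i a k = - Klow p j i k a"
proof -
  have smooth: "smooth_at A p (\<lambda>r. g r (X r) (Y r))" if "X \<in> VF" "Y \<in> VF" for X Y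
    using riem atlas_open_chart that p unfolding riemannian_metric_def smooth_fun_def by blast
  have D: "D (dx i) (dx a) \<in> VF" for i a by (intro D_VF coord_frame_VF)
  have DD: "D (dx j) (D (dx i) (dx a)) p \<in> tangent_space A p" for j i a
    by (intro vector_field_tangent[OF _ p] D_VF coord_frame_VF)
  have d2: "dx j p (\<lambda>q. dx i q (\<lambda>r. gc r a k)) =
      g p (D (dx j) (D (dx i) (dx a)) p) (dx k p) + g p (D (dx i) (dx a) p) (D (dx j) (dx k) p)
      + (g p (D (dx j) (dx a) p) (D (dx i) (dx k) p) + g p (D (dx j) (D (dx i) (dx k)) p) (dx a p))" for i j
  proof -
    have "dx j p (\<lambda>q. dx i q (\<lambda>r. gc r a k)) =
        dx j p (\<lambda>q. g q (D (dx i) (dx a) q) (dx k q) + g q (dx a q) (D (dx i) (dx k) q))"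
      unfolding metric_comp_def
      by (rule tangent_cong[OF p coord_frame_tangent[OF p]]) (simp add: metric coord_frame_VF)
    also have "\<dots> = dx j p (\<lambda>q. g q (D (dx i) (dx a) q) (dx k q)) + dx j p (\<lambda>q. g q (dx a q) (D (dx i) (dx k) q))"
      unfolding coord_frame_def[of A c j] by (rule coord_vec_add_fun[OF p]) (intro smooth D coord_frame_VF)+
    finally show ?thesis
      using g_sym[OF p coord_frame_tangent[OF p] DD] by (simp add: metric coord_frame_VF D p)
  qed
  have sm: "smooth_at A p (\<lambda>r. gc r a k)" using smooth_metric_comp p by (auto simp: smooth_fun_def)
  have "dx j p (\<lambda>q. dx i q (\<lambda>r. gc r a k)) = dx i p (\<lambda>q. dx j q (\<lambda>r. gc r a k))"
    using fun_cong[OF lie_bracket_coord_frame[OF p, of j i], of "\<lambda>r. gc r a k"] sm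
    by (simp add: lie_bracket_def)
  \<comment> \<open>The two terms pairing first derivatives with first derivatives are exchanged by
    swapping \<open>i\<close> and \<open>j\<close>, and cancel.\<close>
  then show ?thesis unfolding d2 curv_low_eq[OF p]
    using g_sym[OF p vector_field_tangent[OF D p] vector_field_tangent[OF D p]] by simp
qed

text \<open>The left side is the index pattern in which the three horizontal brackets enter the
  Koszul formula, before contraction over \<open>a\<close> with the fibre coordinates.\<close>

lemma curv_low_identity:
  "p \<in> fst c \<Longrightarrow> Klow p j i a k - Klow p k i a j - Klow p k j a i = 2 * Klow p a i j k"
  by (rule curvature_index_identity[where K = "Klow p", OF curv_low_anti1 curv_low_anti2 curv_low_bianchi])

end

section \<open>The adapted frame\<close>

locale lifted_chart = riem_chart A c g D for A :: "('p, real^'n::finite) chart set" and c g D +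
  fixes G :: "'p bpoint \<Rightarrow> 'p bpoint tvec \<Rightarrow> 'p bpoint tvec \<Rightarrow> real"
    and Dbar :: "'p bpoint vfield \<Rightarrow> 'p bpoint vfield \<Rightarrow> 'p bpoint vfield"
  assumes lift: "homogeneous_lift A g D G" and lev_bar: "levi_civita (slit_atlas A) G Dbar"

sublocale lifted_chart \<subseteq> B: lc_chart "slit_atlas A" "slit_chart A c" G Dbar
proof
  show "levi_civita (slit_atlas A) G Dbar" by (rule lev_bar)
  show "symmetric_bilinear_on (tangent_space (slit_atlas A) q) (G q)" if "q \<in> fst (slit_chart A c)" for q
    using lift T.in_points[OF that] by (auto simp: homogeneous_lift_def)
qed

context lifted_chart
begin

abbreviation "S \<equiv> fst (slit_chart A c)"
abbreviation "y \<equiv> fibre_coord c"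
abbreviation "yl \<equiv> fibre_coord_low A g c"
abbreviation "N \<equiv> fibre_norm A g c"
abbreviation "E \<equiv> adapted_frame A D c"
abbreviation "dX i q \<equiv> coord_vec (slit_atlas A) (slit_chart A c) q (axis i 1, 0)"
abbreviation "dY i q \<equiv> coord_vec (slit_atlas A) (slit_chart A c) q (0, axis i 1)"

lemma base: "q \<in> S \<Longrightarrow> fst q \<in> fst c"
  by (rule slit_dom_base[folded fst_slit_chart])

lemma smooth_fun_lift: "smooth_fun A (fst c) f \<Longrightarrow> smooth_fun (slit_atlas A) S (\<lambda>r. f (fst r))"
  using smooth_at_lift(1)[folded fst_slit_chart] base by (auto simp: smooth_fun_def)

lemma smooth_fun_y: "smooth_fun (slit_atlas A) S (\<lambda>r. y r m)"
  using smooth_at_fibre_coord(1)[folded fst_slit_chart] by (auto simp: smooth_fun_def)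

lemma coord_vec_slit_split:
  assumes q: "q \<in> S"
  shows "coord_vec (slit_atlas A) (slit_chart A c) q (e, v) f =
    (\<Sum>i\<in>UNIV. e $ i * dX i q f) + (\<Sum>m\<in>UNIV. v $ m * dY m q f)"
proof -
  have ev: "(e, v) = 1 *\<^sub>R (\<Sum>i\<in>UNIV. e $ i *\<^sub>R (axis i 1, 0)) + 1 *\<^sub>R (\<Sum>m\<in>UNIV. v $ m *\<^sub>R (0, axis m 1))"
    by (rule prod_eqI) (simp_all add: fst_sum snd_sum basis_expansion flip: scalar_mult_eq_scaleR)
  show ?thesis
    unfolding ev T.coord_vec_combine[OF q] T.coord_vec_sum[OF q] by simp
qed

lemma adapted_frame_Inr: "E (Inr i) = dY i"
  by (simp add: adapted_frame_def fun_eq_iff)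

lemma adapted_frame_Inl_apply:
  "E (Inl i) q f = dX i q f - (\<Sum>m\<in>UNIV. (\<Sum>a\<in>UNIV. y q a * Gam (fst q) a i m) * dY m q f)"
  by (simp add: adapted_frame_def sum_distrib_right)

lemma adapted_frame_Inl:
  assumes q: "q \<in> S"
  shows "E (Inl i) q = coord_vec (slit_atlas A) (slit_chart A c) q
    (axis i 1, \<chi> m. - (\<Sum>a\<in>UNIV. y q a * Gam (fst q) a i m))"
proof
  fix f
  have "(\<Sum>k\<in>UNIV. (axis i 1 :: real^'n) $ k * dX k q f) = dX i q f"
    by (simp add: axis_def if_distrib[of "\<lambda>x. x * _"] cong: if_cong)
  then show "E (Inl i) q f = coord_vec (slit_atlas A) (slit_chart A c) q
    (axis i 1, \<chi> m. - (\<Sum>a\<in>UNIV. y q a * Gam (fst q) a i m)) f"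
    by (subst coord_vec_slit_split[OF q]) (simp add: adapted_frame_Inl_apply sum_negf)
qed

text \<open>The direction of a horizontal field varies with the point, whereas
  \<open>T.coord_vec_field\<close> covers constant directions. The field is therefore assembled from
  \<open>dX\<close> and \<open>dY\<close> with smooth coefficients.\<close>

lemma adapted_frame_VF: "E \<alpha> \<in> T.VF"
proof (cases \<alpha>)
  case (Inl i)
  have sm: "smooth_fun (slit_atlas A) S (\<lambda>q. - 1 * (\<Sum>a\<in>UNIV. y q a * Gam (fst q) a i m))" for m
    using smooth_fun_lift[OF smooth_christoffel] smooth_fun_y unfolding smooth_fun_def
    by (intro ballI T.smooth_at_mult[OF _ T.smooth_at_const] T.smooth_at_sum T.smooth_at_mult) auto
  have "(\<lambda>q f. dX i q f + (\<Sum>m\<in>UNIV. - 1 * (\<Sum>a\<in>UNIV. y q a * Gam (fst q) a i m) * dY m q f)) \<in> T.VF"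
    by (rule T.vector_field_add[OF T.coord_vec_field T.vector_field_sum[OF T.coord_vec_field sm]])
  then show ?thesis
    by (rule T.vector_field_cong) (simp add: Inl fun_eq_iff adapted_frame_Inl_apply sum_negf)
next
  case (Inr i)
  then show ?thesis using T.coord_vec_field by (simp add: adapted_frame_Inr)
qed

lemma adapted_frame_tangent: "q \<in> S \<Longrightarrow> E \<alpha> q \<in> tangent_space (slit_atlas A) q"
  by (rule T.vector_field_tangent[OF adapted_frame_VF])

lemma adapted_frame_base:
  assumes "q \<in> S" "smooth_at A (fst q) f"
  shows "E (Inl i) q (\<lambda>r. f (fst r)) = dx i (fst q) f" "E (Inr i) q (\<lambda>r. f (fst r)) = 0"
  using smooth_at_lift(2)[folded fst_slit_chart, OF assms] coord_vec_0[OF base[OF assms(1)]]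
  by (simp_all add: adapted_frame_Inl[OF assms(1)] adapted_frame_Inr coord_frame_def)

lemma adapted_frame_x:
  assumes "q \<in> S"
  shows "E (Inl i) q (\<lambda>r. snd c (fst r) $ m) = kron i m" "E (Inr i) q (\<lambda>r. snd c (fst r) $ m) = 0"
  using adapted_frame_base[OF assms smooth_at_linear_coord[OF base[OF assms] bounded_linear_vec_nth]]
    coord_frame_coord[OF base[OF assms]] by simp_all

lemma adapted_frame_y:
  assumes "q \<in> S"
  shows "E (Inl i) q (\<lambda>r. y r m) = - (\<Sum>a\<in>UNIV. y q a * Gam (fst q) a i m)"
    "E (Inr i) q (\<lambda>r. y r m) = kron i m"
  by (simp_all add: adapted_frame_Inl[OF assms] adapted_frame_Inr
      smooth_at_fibre_coord(2)[folded fst_slit_chart, OF assms] kron_def axis_def eq_commute)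

lemma sum_UNIV_sum:
  "(\<Sum>\<gamma>\<in>UNIV. f \<gamma>) = (\<Sum>i\<in>UNIV. f (Inl i)) + (\<Sum>i\<in>UNIV. f (Inr i) :: real)"
  for f :: "'n + 'n \<Rightarrow> real"
  using sum.Plus[of "UNIV :: 'n set" "UNIV :: 'n set" f] by (simp add: UNIV_Plus_UNIV comp_def)

text \<open>The system for the coefficients is triangular: base coordinates see only the horizontal
  fields and settle the \<open>Inl\<close> part, after which the fibre coordinates settle the
  \<open>Inr\<close> part.\<close>

lemma frame_comp_adapted_eqI:
  assumes q: "q \<in> S" and v: "v = (\<lambda>f. \<Sum>\<gamma>\<in>UNIV. a \<gamma> * E \<gamma> q f)"
  shows "frame_comp E q v = a"
  unfolding frame_comp_def
proof (rule the_equality)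
  fix b assume b: "v = (\<lambda>f. \<Sum>\<gamma>\<in>UNIV. b \<gamma> * E \<gamma> q f)"
  have eq: "(\<Sum>\<gamma>\<in>UNIV. b \<gamma> * E \<gamma> q f) = (\<Sum>\<gamma>\<in>UNIV. a \<gamma> * E \<gamma> q f)" for f
    by (rule fun_cong[OF trans[OF b[symmetric] v]])
  have Inl: "b (Inl m) = a (Inl m)" for m
    using eq[of "\<lambda>r. snd c (fst r) $ m"] by (simp add: sum_UNIV_sum adapted_frame_x[OF q])
  have "b (Inr m) = a (Inr m)" for m
    using eq[of "\<lambda>r. y r m"] by (simp add: sum_UNIV_sum adapted_frame_y[OF q] Inl)
  then have "b \<gamma> = a \<gamma>" for \<gamma> using Inl by (cases \<gamma>) simp_all
  then show "b = a" by (rule ext)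
qed (rule v)

text \<open>The coefficients are the dual coframe evaluated on \<open>v\<close>: dx^i in the first
  case, and dy^m + y^a Gamma_ai^m dx^i, the form delta y^m, in the second.\<close>

lemma adapted_frame_expand:
  fixes v
  assumes q: "q \<in> S" and v: "v \<in> tangent_space (slit_atlas A) q"
  defines "a \<equiv> case_sum (\<lambda>i. v (\<lambda>r. snd c (fst r) $ i))
    (\<lambda>m. v (\<lambda>r. y r m) + (\<Sum>i\<in>UNIV. v (\<lambda>r. snd c (fst r) $ i) * (\<Sum>a\<in>UNIV. y q a * Gam (fst q) a i m)))"
  shows "v = (\<lambda>f. \<Sum>\<gamma>\<in>UNIV. a \<gamma> * E \<gamma> q f)"
proof
  fix f
  define x' y' H where "x' i = v (\<lambda>r. snd c (fst r) $ i)" and "y' m = v (\<lambda>r. y r m)"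
    and "H i m = (\<Sum>a\<in>UNIV. y q a * Gam (fst q) a i m)" for i m
  have "v f = coord_vec (slit_atlas A) (slit_chart A c) q (\<chi> m. x' m, \<chi> m. y' m) f"
    using slit_tangentE[folded fst_slit_chart, OF q v] by (simp add: x'_def y'_def)
  also have "\<dots> = (\<Sum>i\<in>UNIV. x' i * dX i q f) + (\<Sum>m\<in>UNIV. y' m * dY m q f)"
    by (subst coord_vec_slit_split[OF q]) simp
  also have "\<dots> = (\<Sum>i\<in>UNIV. x' i * (dX i q f - (\<Sum>m\<in>UNIV. H i m * dY m q f)))
      + (\<Sum>m\<in>UNIV. (y' m + (\<Sum>i\<in>UNIV. x' i * H i m)) * dY m q f)"
  proof -
    have "(\<Sum>i\<in>UNIV. x' i * (\<Sum>m\<in>UNIV. H i m * dY m q f)) = (\<Sum>m\<in>UNIV. (\<Sum>i\<in>UNIV. x' i * H i m) * dY m q f)"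
      unfolding sum_distrib_left sum_distrib_right by (subst sum.swap) (simp add: mult.assoc)
    then show ?thesis by (simp add: right_diff_distrib distrib_right sum_subtractf sum.distrib)
  qed
  also have "\<dots> = (\<Sum>\<gamma>\<in>UNIV. a \<gamma> * E \<gamma> q f)"
    by (simp add: sum_UNIV_sum a_def x'_def y'_def H_def adapted_frame_Inl_apply adapted_frame_Inr)
  finally show "v f = (\<Sum>\<gamma>\<in>UNIV. a \<gamma> * E \<gamma> q f)" .
qed

lemma frame_comp_adapted:
  assumes q: "q \<in> S" and v: "v \<in> tangent_space (slit_atlas A) q"
  shows "frame_comp E q v (Inl i) = v (\<lambda>r. snd c (fst r) $ i)"
    and "frame_comp E q v (Inr m) = v (\<lambda>r. y r m) +
      (\<Sum>i\<in>UNIV. v (\<lambda>r. snd c (fst r) $ i) * (\<Sum>a\<in>UNIV. y q a * Gam (fst q) a i m))"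
    and "v = (\<lambda>f. \<Sum>\<gamma>\<in>UNIV. frame_comp E q v \<gamma> * E \<gamma> q f)"
  using adapted_frame_expand[OF assms] frame_comp_adapted_eqI[OF q adapted_frame_expand[OF assms]]
  by simp_all

section \<open>The homogeneous lift\<close>

text \<open>\<open>Q\<close> is the squared fibre norm. It is a quadratic polynomial in the fibre
  coordinates, so its derivatives need only the product rule; \<phi> is then treated as a power of
  it.\<close>

definition "Q q = (\<Sum>i\<in>UNIV. \<Sum>j\<in>UNIV. gc (fst q) i j * y q i * y q j)"
definition "\<phi> q = 2 / N q"

lemma lift_adapted:
  assumes "q \<in> S"
  shows "G q (E (Inl i) q) (E (Inl j) q) = 0" "G q (E (Inr i) q) (E (Inr j) q) = 0"
    "G q (E (Inl i) q) (E (Inr j) q) = \<phi> q * gc (fst q) i j"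
    "G q (E (Inr j) q) (E (Inl i) q) = \<phi> q * gc (fst q) i j"
  using lift chart assms unfolding homogeneous_lift_def fst_slit_chart \<phi>_def by blast+

text \<open>The blocks of \<open>G\<close> pairing fields of equal type vanish, which is why the
  type of the extracted component is opposite to that of the test field.\<close>

lemma lift_comp:
  assumes q: "q \<in> S" and v: "v \<in> tangent_space (slit_atlas A) q"
  shows "G q v (E (Inl k) q) = \<phi> q * (\<Sum>m\<in>UNIV. frame_comp E q v (Inr m) * gc (fst q) m k)"
    and "G q v (E (Inr k) q) = \<phi> q * (\<Sum>m\<in>UNIV. frame_comp E q v (Inl m) * gc (fst q) m k)"
proof -
  have "G q v (E \<delta> q) = (\<Sum>\<gamma>\<in>UNIV. frame_comp E q v \<gamma> * G q (E \<gamma> q) (E \<delta> q))" for \<delta>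
    by (subst (1) frame_comp_adapted(3)[OF q v])
      (simp add: B.g_sum[OF q _ adapted_frame_tangent[OF q] adapted_frame_tangent[OF q]])
  then show "G q v (E (Inl k) q) = \<phi> q * (\<Sum>m\<in>UNIV. frame_comp E q v (Inr m) * gc (fst q) m k)"
    "G q v (E (Inr k) q) = \<phi> q * (\<Sum>m\<in>UNIV. frame_comp E q v (Inl m) * gc (fst q) m k)"
    by (simp_all add: sum_UNIV_sum lift_adapted[OF q] sum_distrib_left mult_ac metric_comp_sym[OF base[OF q], of k])
qed

lemma Q_pos: assumes "q \<in> S" shows "Q q > 0"
proof -
  obtain p e where "p \<in> fst c" "e \<noteq> 0" "q = (p, coord_vec A c p e)"
    using assms slit_domE fst_slit_chart by metis
  then show ?thesis using metric_comp_pos[of p e] by (simp add: Q_def fibre_coord_coord_vec)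
qed

lemma fibre_norm_sq: "q \<in> S \<Longrightarrow> (N q)\<^sup>2 = Q q"
  using Q_pos[of q] by (simp add: fibre_norm_def Q_def)

lemma \<phi>_pos: "q \<in> S \<Longrightarrow> \<phi> q > 0"
  using Q_pos[of q] by (simp add: fibre_norm_def Q_def \<phi>_def)

lemma \<phi>_eq: "q \<in> S \<Longrightarrow> \<phi> q = 2 * Q q powr (- 1 / 2)"
  using Q_pos[of q]
  by (simp add: fibre_norm_def \<phi>_def powr_minus_divide powr_half_sqrt flip: Q_def)

lemma smooth_at_parts:
  assumes "q \<in> S"
  shows "smooth_at (slit_atlas A) q (\<lambda>r. gc (fst r) i j)" "smooth_at (slit_atlas A) q (\<lambda>r. y r i)"
    "smooth_at (slit_atlas A) q (\<lambda>r. gc (fst r) i j * y r i)"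
    "smooth_at (slit_atlas A) q (\<lambda>r. gc (fst r) i j * y r i * y r j)"
proof -
  show *: "smooth_at (slit_atlas A) q (\<lambda>r. gc (fst r) i j)" "smooth_at (slit_atlas A) q (\<lambda>r. y r i)" for i
    using smooth_fun_lift[OF smooth_metric_comp] smooth_fun_y assms by (auto simp: smooth_fun_def)
  show "smooth_at (slit_atlas A) q (\<lambda>r. gc (fst r) i j * y r i)"
    "smooth_at (slit_atlas A) q (\<lambda>r. gc (fst r) i j * y r i * y r j)"
    by (intro T.smooth_at_mult assms *)+
qed

lemma smooth_Q: "smooth_fun (slit_atlas A) S Q"
  unfolding smooth_fun_def Q_def by (auto intro!: T.smooth_at_sum smooth_at_parts)

lemma deriv_Q:
  assumes q: "q \<in> S" and v: "v \<in> tangent_space (slit_atlas A) q"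
  shows "v Q = (\<Sum>i\<in>UNIV. \<Sum>j\<in>UNIV. v (\<lambda>r. gc (fst r) i j) * y q i * y q j) + 2 * (\<Sum>i\<in>UNIV. yl q i * v (\<lambda>r. y r i))"
proof -
  have "v Q = (\<Sum>i\<in>UNIV. \<Sum>j\<in>UNIV. v (\<lambda>r. gc (fst r) i j * y r i * y r j))"
    unfolding Q_def[abs_def] by (simp add: T.tangent_sum_fun[OF q v] T.smooth_at_sum[OF q] smooth_at_parts[OF q])
  also have "\<dots> = (\<Sum>i\<in>UNIV. \<Sum>j\<in>UNIV. v (\<lambda>r. gc (fst r) i j) * y q i * y q j
      + gc (fst q) i j * y q i * v (\<lambda>r. y r j) + gc (fst q) i j * y q j * v (\<lambda>r. y r i))"
    by (simp add: T.tangent_mult_fun[OF q v] smooth_at_parts[OF q]) (simp add: algebra_simps)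
  also have "\<dots> = (\<Sum>i\<in>UNIV. \<Sum>j\<in>UNIV. v (\<lambda>r. gc (fst r) i j) * y q i * y q j)
      + (\<Sum>i\<in>UNIV. \<Sum>j\<in>UNIV. gc (fst q) i j * y q i * v (\<lambda>r. y r j))
      + (\<Sum>i\<in>UNIV. yl q i * v (\<lambda>r. y r i))"
    by (simp add: sum.distrib fibre_coord_low_def sum_distrib_right)
  \<comment> \<open>Exchanging \<open>i\<close> and \<open>j\<close> and using symmetry of the
    metric makes this sum equal to the other one; hence the factor 2.\<close>
  also have "(\<Sum>i\<in>UNIV. \<Sum>j\<in>UNIV. gc (fst q) i j * y q i * v (\<lambda>r. y r j)) = (\<Sum>i\<in>UNIV. yl q i * v (\<lambda>r. y r i))"
    by (subst sum.swap) (simp add: fibre_coord_low_def sum_distrib_right metric_comp_sym[OF base[OF q]])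
  finally show ?thesis by simp
qed

lemma adapted_frame_metric_comp:
  assumes q: "q \<in> S"
  shows "E (Inl k) q (\<lambda>r. gc (fst r) i j) = dx k (fst q) (\<lambda>p. gc p i j)"
    "E (Inr k) q (\<lambda>r. gc (fst r) i j) = 0"
  using adapted_frame_base[OF q, of "\<lambda>p. gc p i j"] smooth_metric_comp base[OF q] by (simp_all add: smooth_fun_def)

text \<open>Both Christoffel terms in the derivative of g_ij contract with y^i y^j to the same sum,
  and the horizontal derivative of the fibre coordinates subtracts exactly twice that sum. For a
  vertical field g_ij is constant and only y is differentiated.\<close>

lemma adapted_frame_Q:
  assumes q: "q \<in> S"
  shows "E (Inl k) q Q = 0" and "E (Inr k) q Q = 2 * yl q k"
proof -
  let ?p = "fst q"
  have p: "?p \<in> fst c" by (rule base[OF q])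
  define W where "W i j = (\<Sum>m\<in>UNIV. Gam ?p i k m * gc ?p m j)" for i j
  have "(\<Sum>i\<in>UNIV. \<Sum>j\<in>UNIV. dx k ?p (\<lambda>p. gc p i j) * y q i * y q j) =
      (\<Sum>i\<in>UNIV. \<Sum>j\<in>UNIV. W i j * y q i * y q j) + (\<Sum>i\<in>UNIV. \<Sum>j\<in>UNIV. W j i * y q i * y q j)"
    by (simp add: deriv_metric_comp[OF p] W_def distrib_right sum.distrib)
  also have "(\<Sum>i\<in>UNIV. \<Sum>j\<in>UNIV. W j i * y q i * y q j) = (\<Sum>i\<in>UNIV. \<Sum>j\<in>UNIV. W i j * y q i * y q j)"
    by (subst sum.swap) (simp add: mult_ac)
  also have "(\<Sum>i\<in>UNIV. \<Sum>j\<in>UNIV. W i j * y q i * y q j) =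
      (\<Sum>m\<in>UNIV. yl q m * (\<Sum>a\<in>UNIV. y q a * Gam ?p a k m))"
  proof -
    have "(\<Sum>j\<in>UNIV. W i j * y q i * y q j) = (\<Sum>m\<in>UNIV. yl q m * (y q i * Gam ?p i k m))" for i
      unfolding W_def fibre_coord_low_def sum_distrib_right
      by (subst sum.swap) (simp add: mult_ac)
    then show ?thesis by (simp add: sum_distrib_left) (rule sum.swap)
  qed
  finally show "E (Inl k) q Q = 0"
    unfolding deriv_Q[OF q adapted_frame_tangent[OF q]] adapted_frame_metric_comp[OF q] adapted_frame_y[OF q]
    by (simp add: sum_negf)
  show "E (Inr k) q Q = 2 * yl q k"
    unfolding deriv_Q[OF q adapted_frame_tangent[OF q]] adapted_frame_metric_comp[OF q] adapted_frame_y[OF q]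
    by simp
qed

lemma smooth_\<phi>: "q \<in> S \<Longrightarrow> smooth_at (slit_atlas A) q \<phi>"
  using T.smooth_at_mult[OF _ T.smooth_at_const T.smooth_at_powr[OF _ smooth_Q Q_pos], of q 2 "-1/2"]
    T.smooth_at_cong[OF _ \<phi>_eq, of q] by simp

text \<open>Since \<phi> is a constant times \<open>Q\<close> to the power -1/2, its logarithmic
  derivative is -1/2 times that of \<open>Q\<close>. This form keeps \<phi> as a common factor that
  cancels in the end.\<close>

lemma deriv_\<phi>:
  assumes q: "q \<in> S" and v: "v \<in> tangent_space (slit_atlas A) q"
  shows "v \<phi> = - (\<phi> q / (2 * Q q)) * v Q"
proof -
  have "v \<phi> = v (\<lambda>r. 2 * Q r powr (- 1 / 2))" by (rule T.tangent_cong[OF q v \<phi>_eq])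
  also have "\<dots> = 2 * v (\<lambda>r. Q r powr (- 1 / 2))"
    using T.tangent_mult_fun[OF q v T.smooth_at_const[OF q] T.smooth_at_powr[OF q smooth_Q Q_pos], of 2 "-1/2"]
      T.tangent_const[OF q v] by simp
  also have "\<dots> = - (Q q powr (- 1 / 2 - 1)) * v Q"
    by (simp add: T.tangent_powr_fun[OF q v smooth_Q Q_pos])
  also have "Q q powr (- 1 / 2 - 1) = \<phi> q / (2 * Q q)"
    using Q_pos[OF q] powr_diff[of "Q q" "- 1 / 2" 1] by (simp add: \<phi>_eq[OF q])
  finally show ?thesis .
qed

lemma adapted_frame_lift_comp:
  assumes q: "q \<in> S"
  shows "E (Inl k) q (\<lambda>r. \<phi> r * gc (fst r) i j) = \<phi> q * dx k (fst q) (\<lambda>p. gc p i j)"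
    and "E (Inr k) q (\<lambda>r. \<phi> r * gc (fst r) i j) = - (\<phi> q / Q q) * yl q k * gc (fst q) i j"
  using T.tangent_mult_fun[OF q adapted_frame_tangent[OF q] smooth_\<phi>[OF q] smooth_at_parts(1)[OF q]]
  by (simp_all add: deriv_\<phi>[OF q adapted_frame_tangent[OF q]] adapted_frame_Q[OF q] adapted_frame_metric_comp[OF q])

lemma deriv_lift:
  assumes q: "q \<in> S" and v: "v \<in> tangent_space (slit_atlas A) q"
  shows "v (\<lambda>r. G r (E (Inl i) r) (E (Inl j) r)) = 0" "v (\<lambda>r. G r (E (Inr i) r) (E (Inr j) r)) = 0"
    "v (\<lambda>r. G r (E (Inl i) r) (E (Inr j) r)) = v (\<lambda>r. \<phi> r * gc (fst r) i j)"
    "v (\<lambda>r. G r (E (Inr j) r) (E (Inl i) r)) = v (\<lambda>r. \<phi> r * gc (fst r) i j)"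
  using T.tangent_cong[OF q v lift_adapted(1)] T.tangent_cong[OF q v lift_adapted(2)]
    T.tangent_cong[OF q v lift_adapted(3)] T.tangent_cong[OF q v lift_adapted(4)] T.tangent_const[OF q v]
  by simp_all

section \<open>Brackets of the adapted frame\<close>

abbreviation "br \<alpha> \<beta> \<equiv> lie_bracket (slit_atlas A) (E \<alpha>) (E \<beta>)"

lemma br_tangent: "q \<in> S \<Longrightarrow> br \<alpha> \<beta> q \<in> tangent_space (slit_atlas A) q"
  by (rule B.lie_bracket_tangent[OF adapted_frame_VF adapted_frame_VF])

text \<open>Each frame field takes a constant value on a base coordinate function, so a second field
  annihilates the result.\<close>

lemma br_x:
  assumes q: "q \<in> S"
  shows "br \<alpha> \<beta> q (\<lambda>r. snd c (fst r) $ m) = 0"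
proof -
  let ?x = "\<lambda>r. snd c (fst r) $ m"
  have sm: "smooth_at (slit_atlas A) q ?x"
    using smooth_at_lift(1)[folded fst_slit_chart, OF q smooth_at_linear_coord[OF base[OF q] bounded_linear_vec_nth]] .
  have "E \<alpha> q (\<lambda>r. E \<beta> r ?x) = 0" for \<alpha> \<beta>
    using T.tangent_cong[OF q adapted_frame_tangent[OF q] adapted_frame_x(1)]
      T.tangent_cong[OF q adapted_frame_tangent[OF q] adapted_frame_x(2)]
      T.tangent_const[OF q adapted_frame_tangent[OF q]] by (cases \<beta>) simp_all
  then show ?thesis by (simp add: lie_bracket_def sm)
qed

text \<open>The quantity differentiated is - y^a Gamma_ai^m. A vertical field acts on y^a only; a
  horizontal field acts on both factors and produces the quadratic and the derivative parts of the
  curvature.\<close>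

lemma adapted_frame_y2:
  assumes q: "q \<in> S"
  shows "E \<alpha> q (\<lambda>r. E (Inr j) r (\<lambda>r. y r m)) = 0"
    and "E (Inr j) q (\<lambda>r. E (Inl i) r (\<lambda>r. y r m)) = - Gam (fst q) j i m"
    and "E (Inl j) q (\<lambda>r. E (Inl i) r (\<lambda>r. y r m)) = (\<Sum>a\<in>UNIV. y q a *
      ((\<Sum>l\<in>UNIV. Gam (fst q) a j l * Gam (fst q) l i m) - dx j (fst q) (\<lambda>p. Gam p a i m)))"
proof -
  note t = adapted_frame_tangent[OF q]
  show "E \<alpha> q (\<lambda>r. E (Inr j) r (\<lambda>r. y r m)) = 0"
    using T.tangent_cong[OF q t adapted_frame_y(2)] T.tangent_const[OF q t] by simp
  have sG: "smooth_at A (fst q) (\<lambda>p. Gam p a i m)" for a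
    using smooth_christoffel base[OF q] by (simp add: smooth_fun_def)
  note sGT = smooth_at_lift(1)[folded fst_slit_chart, OF q sG]
  note sy = smooth_at_parts(2)[OF q]
  have *: "E \<alpha> q (\<lambda>r. E (Inl i) r (\<lambda>r. y r m)) =
      - (\<Sum>a\<in>UNIV. y q a * E \<alpha> q (\<lambda>r. Gam (fst r) a i m) + Gam (fst q) a i m * E \<alpha> q (\<lambda>r. y r a))" for \<alpha>
  proof -
    have "E \<alpha> q (\<lambda>r. E (Inl i) r (\<lambda>r. y r m)) = E \<alpha> q (\<lambda>r. (- 1) * (\<Sum>a\<in>UNIV. y r a * Gam (fst r) a i m))"
      by (rule T.tangent_cong[OF q t]) (simp add: adapted_frame_y)
    also have "\<dots> = - E \<alpha> q (\<lambda>r. \<Sum>a\<in>UNIV. y r a * Gam (fst r) a i m)"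
      by (subst T.tangent_mult_fun[OF q t T.smooth_at_const[OF q]])
        (auto intro!: T.smooth_at_sum[OF q] T.smooth_at_mult[OF q] sGT sy simp: T.tangent_const[OF q t])
    also have "\<dots> = - (\<Sum>a\<in>UNIV. E \<alpha> q (\<lambda>r. y r a * Gam (fst r) a i m))"
      by (simp add: T.tangent_sum_fun[OF q t] T.smooth_at_mult[OF q] sGT sy)
    finally show ?thesis by (simp add: T.tangent_mult_fun[OF q t sy sGT])
  qed
  show "E (Inr j) q (\<lambda>r. E (Inl i) r (\<lambda>r. y r m)) = - Gam (fst q) j i m"
    unfolding * by (simp add: adapted_frame_base[OF q sG] adapted_frame_y[OF q])
  have "(\<Sum>a\<in>UNIV. Gam (fst q) a i m * (\<Sum>b\<in>UNIV. y q b * Gam (fst q) b j a)) =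
      (\<Sum>a\<in>UNIV. y q a * (\<Sum>l\<in>UNIV. Gam (fst q) a j l * Gam (fst q) l i m))"
    unfolding sum_distrib_left by (subst sum.swap) (simp add: mult_ac)
  then show "E (Inl j) q (\<lambda>r. E (Inl i) r (\<lambda>r. y r m)) = (\<Sum>a\<in>UNIV. y q a *
      ((\<Sum>l\<in>UNIV. Gam (fst q) a j l * Gam (fst q) l i m) - dx j (fst q) (\<lambda>p. Gam p a i m)))"
    unfolding * by (simp add: adapted_frame_base[OF q sG] adapted_frame_y[OF q] right_diff_distrib
        sum.distrib sum_negf sum_subtractf)
qed

text \<open>The minus sign in - y^a Gamma_ai^m reverses the first two curvature indices: the bracket
  of the horizontal fields \<open>i\<close> and \<open>j\<close> carries \<open>K\<close> with
  indices \<open>j\<close>, \<open>i\<close>.\<close>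

lemma br_y:
  assumes q: "q \<in> S"
  shows "br (Inl i) (Inl j) q (\<lambda>r. y r m) = (\<Sum>a\<in>UNIV. y q a * K (fst q) j i a m)"
    "br (Inl i) (Inr j) q (\<lambda>r. y r m) = Gam (fst q) j i m"
    "br (Inr j) (Inl i) q (\<lambda>r. y r m) = - Gam (fst q) j i m"
    "br (Inr i) (Inr j) q (\<lambda>r. y r m) = 0"
  by (simp_all add: lie_bracket_def smooth_at_parts[OF q] adapted_frame_y2[OF q] curv_comp_eq[OF base[OF q]]
      algebra_simps flip: sum_subtractf)

lemma lift_br:
  assumes q: "q \<in> S"
  shows "G q (br \<alpha> \<beta> q) (E (Inr k) q) = 0"
    "G q (br \<alpha> \<beta> q) (E (Inl k) q) = \<phi> q * (\<Sum>m\<in>UNIV. br \<alpha> \<beta> q (\<lambda>r. y r m) * gc (fst q) m k)"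
  by (simp_all add: lift_comp[OF q br_tangent[OF q]] frame_comp_adapted(1,2)[OF q br_tangent[OF q]] br_x[OF q])

section \<open>The connection coefficients\<close>

lemma koszul_adapted:
  assumes "q \<in> S"
  shows "2 * G q (Dbar (E \<alpha>) (E \<beta>) q) (E \<gamma> q) =
    E \<alpha> q (\<lambda>r. G r (E \<beta> r) (E \<gamma> r)) + E \<beta> q (\<lambda>r. G r (E \<alpha> r) (E \<gamma> r)) - E \<gamma> q (\<lambda>r. G r (E \<alpha> r) (E \<beta> r))
    + G q (br \<alpha> \<beta> q) (E \<gamma> q) - G q (br \<alpha> \<gamma> q) (E \<beta> q) - G q (br \<beta> \<gamma> q) (E \<alpha> q)"
  by (rule B.koszul[OF adapted_frame_VF adapted_frame_VF adapted_frame_VF assms])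

text \<open>The 2 is kept to match the Koszul formula. It and the positive \<phi> cancel, and
  nondegeneracy of the base metric identifies the components.\<close>

lemma conn_coeff_eqI:
  assumes q: "q \<in> S"
  shows "(\<And>k. 2 * G q (Dbar (E \<alpha>) (E \<beta>) q) (E (Inr k) q) = 2 * \<phi> q * (\<Sum>m\<in>UNIV. w m * gc (fst q) m k)) \<Longrightarrow>
      conn_coeff Dbar E q \<beta> \<alpha> (Inl h) = w h"
    and "(\<And>k. 2 * G q (Dbar (E \<alpha>) (E \<beta>) q) (E (Inl k) q) = 2 * \<phi> q * (\<Sum>m\<in>UNIV. w m * gc (fst q) m k)) \<Longrightarrow>
      conn_coeff Dbar E q \<beta> \<alpha> (Inr h) = w h"
proof -
  have t: "Dbar (E \<alpha>) (E \<beta>) q \<in> tangent_space (slit_atlas A) q"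
    by (rule T.vector_field_tangent[OF B.D_VF[OF adapted_frame_VF adapted_frame_VF] q])
  show "conn_coeff Dbar E q \<beta> \<alpha> (Inl h) = w h"
    if "\<And>k. 2 * G q (Dbar (E \<alpha>) (E \<beta>) q) (E (Inr k) q) = 2 * \<phi> q * (\<Sum>m\<in>UNIV. w m * gc (fst q) m k)"
    unfolding conn_coeff_def
    by (rule metric_comp_nondegenerate[OF base[OF q]]) (use that \<phi>_pos[OF q] in \<open>simp add: lift_comp[OF q t]\<close>)
  show "conn_coeff Dbar E q \<beta> \<alpha> (Inr h) = w h"
    if "\<And>k. 2 * G q (Dbar (E \<alpha>) (E \<beta>) q) (E (Inl k) q) = 2 * \<phi> q * (\<Sum>m\<in>UNIV. w m * gc (fst q) m k)"
    unfolding conn_coeff_def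
    by (rule metric_comp_nondegenerate[OF base[OF q]]) (use that \<phi>_pos[OF q] in \<open>simp add: lift_comp[OF q t]\<close>)
qed

lemma lower_y: "q \<in> S \<Longrightarrow> (\<Sum>m\<in>UNIV. y q m * gc (fst q) m k) = yl q k"
  by (simp add: fibre_coord_low_def metric_comp_sym[OF base] mult.commute)

text \<open>With three horizontal fields only the brackets survive, with three vertical ones
  nothing. With two horizontal fields the derivatives of g_ij and the mixed brackets survive, both
  made of Christoffel symbols; with two vertical fields only the derivatives of \<phi> do.\<close>

lemma koszul_simps:
  assumes q: "q \<in> S"
  shows "2 * G q (Dbar (E (Inl i)) (E (Inl j)) q) (E (Inr k) q) =
      2 * \<phi> q * (\<Sum>m\<in>UNIV. Gam (fst q) j i m * gc (fst q) m k)"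
    "2 * G q (Dbar (E (Inl i)) (E (Inl j)) q) (E (Inl k) q) =
      2 * \<phi> q * (\<Sum>m\<in>UNIV. (\<Sum>a\<in>UNIV. y q a * K (fst q) a i j m) * gc (fst q) m k)"
    "2 * G q (Dbar (E (Inl i)) (E (Inr j)) q) (E (Inr k) q) =
      2 * \<phi> q * ((gc (fst q) i j * yl q k - gc (fst q) i k * yl q j) / (2 * Q q))"
    "2 * G q (Dbar (E (Inr i)) (E (Inl j)) q) (E (Inr k) q) =
      2 * \<phi> q * ((gc (fst q) i j * yl q k - gc (fst q) j k * yl q i) / (2 * Q q))"
    "2 * G q (Dbar (E (Inl i)) (E (Inr j)) q) (E (Inl k) q) =
      2 * \<phi> q * (\<Sum>m\<in>UNIV. Gam (fst q) j i m * gc (fst q) m k)"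
    "2 * G q (Dbar (E (Inr i)) (E (Inl j)) q) (E (Inl k) q) = 0"
    "2 * G q (Dbar (E (Inr i)) (E (Inr j)) q) (E (Inr k) q) = 0"
    "2 * G q (Dbar (E (Inr i)) (E (Inr j)) q) (E (Inl k) q) =
      - 2 * \<phi> q * ((gc (fst q) i k * yl q j + gc (fst q) j k * yl q i) / (2 * Q q))"
proof -
  let ?p = "fst q"
  have p: "?p \<in> fst c" by (rule base[OF q])
  note t = adapted_frame_tangent[OF q]
  note kos = koszul_adapted[OF q] deriv_lift[OF q t] lift_br[OF q] br_y[OF q]
    adapted_frame_lift_comp[OF q] deriv_metric_comp[OF p]
  have Q: "Q q \<noteq> 0" using Q_pos[OF q] by simp
  have Gs: "Gam ?p a b = Gam ?p b a" for a b
    using christoffel_sym[OF p] by blast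
  have gs: "gc ?p a b = gc ?p b a" for a b
    by (rule metric_comp_sym[OF p])
  \<comment> \<open>The sum over \<open>a\<close> is moved outside so that the curvature identity
    applies to each summand.\<close>
  have Kl: "(\<Sum>m\<in>UNIV. (\<Sum>a\<in>UNIV. y q a * K ?p i j a m) * gc ?p m k) = (\<Sum>a\<in>UNIV. y q a * Klow ?p i j a k)" for i j k
    unfolding sum_distrib_right sum_distrib_left by (subst sum.swap) (simp add: mult_ac)
  have Kl': "(\<Sum>m\<in>UNIV. (\<Sum>a\<in>UNIV. y q a * K ?p a i j m) * gc ?p m k) = (\<Sum>a\<in>UNIV. y q a * Klow ?p a i j k)" for i j k
    unfolding sum_distrib_right sum_distrib_left by (subst sum.swap) (simp add: mult_ac)
  show "2 * G q (Dbar (E (Inl i)) (E (Inl j)) q) (E (Inr k) q) =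
      2 * \<phi> q * (\<Sum>m\<in>UNIV. Gam (fst q) j i m * gc (fst q) m k)"
    unfolding kos by (simp add: Gs gs algebra_simps)
  have "(\<Sum>a\<in>UNIV. y q a * Klow ?p j i a k) - (\<Sum>a\<in>UNIV. y q a * Klow ?p k i a j)
      - (\<Sum>a\<in>UNIV. y q a * Klow ?p k j a i) = 2 * (\<Sum>a\<in>UNIV. y q a * Klow ?p a i j k)"
  proof -
    have "(\<Sum>a\<in>UNIV. y q a * (Klow ?p j i a k - Klow ?p k i a j - Klow ?p k j a i)) =
        2 * (\<Sum>a\<in>UNIV. y q a * Klow ?p a i j k)"
      unfolding curv_low_identity[OF p]
      by (rule trans[OF sum.cong[OF refl mult.left_commute] sum_distrib_left[symmetric]])
    then show ?thesis by (simp only: right_diff_distrib sum_subtractf)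
  qed
  then show "2 * G q (Dbar (E (Inl i)) (E (Inl j)) q) (E (Inl k) q) =
      2 * \<phi> q * (\<Sum>m\<in>UNIV. (\<Sum>a\<in>UNIV. y q a * K (fst q) a i j m) * gc (fst q) m k)"
    unfolding kos Kl Kl' by (simp add: algebra_simps)
  show "2 * G q (Dbar (E (Inl i)) (E (Inr j)) q) (E (Inr k) q) =
      2 * \<phi> q * ((gc (fst q) i j * yl q k - gc (fst q) i k * yl q j) / (2 * Q q))"
    unfolding kos using Q by (simp add: field_simps)
  show "2 * G q (Dbar (E (Inr i)) (E (Inl j)) q) (E (Inr k) q) =
      2 * \<phi> q * ((gc (fst q) i j * yl q k - gc (fst q) j k * yl q i) / (2 * Q q))"
    unfolding kos gs[of j i] using Q by (simp add: field_simps)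
  show "2 * G q (Dbar (E (Inl i)) (E (Inr j)) q) (E (Inl k) q) =
      2 * \<phi> q * (\<Sum>m\<in>UNIV. Gam (fst q) j i m * gc (fst q) m k)"
    unfolding kos by (simp add: Gs gs algebra_simps sum_negf)
  show "2 * G q (Dbar (E (Inr i)) (E (Inl j)) q) (E (Inl k) q) = 0"
    unfolding kos by (simp add: Gs gs algebra_simps sum_negf)
  show "2 * G q (Dbar (E (Inr i)) (E (Inr j)) q) (E (Inr k) q) = 0"
    unfolding kos by simp
  show "2 * G q (Dbar (E (Inr i)) (E (Inr j)) q) (E (Inl k) q) =
      - 2 * \<phi> q * ((gc (fst q) i k * yl q j + gc (fst q) j k * yl q i) / (2 * Q q))"
    unfolding kos gs[of k] using Q by (simp add: field_simps)
qed

text \<open>Lowers the upper index of the claimed coefficients, to match the right sides coming from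
  the Koszul formula. The scalar \<open>a\<close> stands for 1 / (2 Q) up to sign.\<close>

lemma lower_combination:
  assumes q: "q \<in> S"
  shows "(\<Sum>m\<in>UNIV. (a * (b * y q m - kron i m * e)) * gc (fst q) m k) = a * (b * yl q k - gc (fst q) i k * e)"
    and "(\<Sum>m\<in>UNIV. (a * (kron i m * b + kron j m * e)) * gc (fst q) m k) = a * (gc (fst q) i k * b + gc (fst q) j k * e)"
proof -
  have kr: "(\<Sum>m\<in>UNIV. kron i m * e * gc (fst q) m k) = gc (fst q) i k * e" for i e
    using sum_kron(4)[of i "\<lambda>m. e * gc (fst q) m k"] by (simp add: mult_ac)
  have yl: "(\<Sum>m\<in>UNIV. b * y q m * gc (fst q) m k) = b * yl q k"
    using lower_y[OF q, of k] by (simp add: mult.assoc flip: sum_distrib_left)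
  show "(\<Sum>m\<in>UNIV. (a * (b * y q m - kron i m * e)) * gc (fst q) m k) = a * (b * yl q k - gc (fst q) i k * e)"
    by (simp add: mult.assoc[of a] left_diff_distrib sum_subtractf yl kr flip: sum_distrib_left)
  show "(\<Sum>m\<in>UNIV. (a * (kron i m * b + kron j m * e)) * gc (fst q) m k) = a * (gc (fst q) i k * b + gc (fst q) j k * e)"
    by (simp add: mult.assoc[of a] distrib_right sum.distrib kr flip: sum_distrib_left)
qed

lemma lift_conn_coeff:
  assumes q: "q \<in> S"
  shows "conn_coeff Dbar E q (Inl j) (Inl i) (Inl h) = Gam (fst q) j i h"
    "conn_coeff Dbar E q (Inl j) (Inl i) (Inr h) = (\<Sum>a\<in>UNIV. y q a * K (fst q) a i j h)"
    "conn_coeff Dbar E q (Inr j) (Inl i) (Inl h) = 1 / (2 * (N q)\<^sup>2) * (gc (fst q) i j * y q h - kron i h * yl q j)"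
    "conn_coeff Dbar E q (Inl j) (Inr i) (Inl h) = 1 / (2 * (N q)\<^sup>2) * (gc (fst q) i j * y q h - kron j h * yl q i)"
    "conn_coeff Dbar E q (Inr j) (Inl i) (Inr h) = Gam (fst q) j i h"
    "conn_coeff Dbar E q (Inl j) (Inr i) (Inr h) = 0"
    "conn_coeff Dbar E q (Inr j) (Inr i) (Inl h) = 0"
    "conn_coeff Dbar E q (Inr j) (Inr i) (Inr h) = - 1 / (2 * (N q)\<^sup>2) * (kron i h * yl q j + kron j h * yl q i)"
proof -
  note eqI = conn_coeff_eqI[OF q] and kos = koszul_simps[OF q] and low = lower_combination[OF q]
  show "conn_coeff Dbar E q (Inl j) (Inl i) (Inl h) = Gam (fst q) j i h"
    by (rule eqI(1)[where w = "Gam (fst q) j i"]) (rule kos(1))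
  show "conn_coeff Dbar E q (Inl j) (Inl i) (Inr h) = (\<Sum>a\<in>UNIV. y q a * K (fst q) a i j h)"
    by (rule eqI(2)[where w = "\<lambda>h. \<Sum>a\<in>UNIV. y q a * K (fst q) a i j h"]) (rule kos(2))
  show "conn_coeff Dbar E q (Inr j) (Inl i) (Inl h) = 1 / (2 * (N q)\<^sup>2) * (gc (fst q) i j * y q h - kron i h * yl q j)"
    unfolding fibre_norm_sq[OF q]
    by (rule eqI(1)[where w = "\<lambda>h. 1 / (2 * Q q) * (gc (fst q) i j * y q h - kron i h * yl q j)"])
      (unfold kos(3) low, simp)
  show "conn_coeff Dbar E q (Inl j) (Inr i) (Inl h) = 1 / (2 * (N q)\<^sup>2) * (gc (fst q) i j * y q h - kron j h * yl q i)"
    unfolding fibre_norm_sq[OF q]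
    by (rule eqI(1)[where w = "\<lambda>h. 1 / (2 * Q q) * (gc (fst q) i j * y q h - kron j h * yl q i)"])
      (unfold kos(4) low, simp)
  show "conn_coeff Dbar E q (Inr j) (Inl i) (Inr h) = Gam (fst q) j i h"
    by (rule eqI(2)[where w = "Gam (fst q) j i"]) (rule kos(5))
  show "conn_coeff Dbar E q (Inl j) (Inr i) (Inr h) = 0"
    by (rule eqI(2)[where w = "\<lambda>h. 0"]) (unfold kos(6), simp)
  show "conn_coeff Dbar E q (Inr j) (Inr i) (Inl h) = 0"
    by (rule eqI(1)[where w = "\<lambda>h. 0"]) (unfold kos(7), simp)
  show "conn_coeff Dbar E q (Inr j) (Inr i) (Inr h) = - 1 / (2 * (N q)\<^sup>2) * (kron i h * yl q j + kron j h * yl q i)"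
    unfolding fibre_norm_sq[OF q]
    by (rule eqI(2)[where w = "\<lambda>h. - 1 / (2 * Q q) * (kron i h * yl q j + kron j h * yl q i)"])
      (unfold kos(8) low, simp)
qed

end

theorem lemma4:
  fixes A :: "('m, real^'n::finite) chart set"
    and g :: "'m \<Rightarrow> 'm tvec \<Rightarrow> 'm tvec \<Rightarrow> real"
    and D :: "'m vfield \<Rightarrow> 'm vfield \<Rightarrow> 'm vfield"
    and G :: "'m bpoint \<Rightarrow> 'm bpoint tvec \<Rightarrow> 'm bpoint tvec \<Rightarrow> real"
    and Dbar :: "'m bpoint vfield \<Rightarrow> 'm bpoint vfield \<Rightarrow> 'm bpoint vfield"
    and c :: "('m, real^'n) chart"
    and q :: "'m bpoint"
    and i j h :: 'n
  assumes "smooth_manifold A"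
    and "riemannian_metric A g"
    and "levi_civita A g D"
    and "homogeneous_lift A g D G"
    and "levi_civita (slit_atlas A) G Dbar"
    and "c \<in> A"
    and "q \<in> slit_dom A c"
  shows "let g' = metric_comp A g c (fst q);
             \<Gamma> = christoffel A D c (fst q);
             K = curv_comp A D c (fst q);
             y = fibre_coord c q;
             yl = fibre_coord_low A g c q;
             N = fibre_norm A g c q;
             \<Gamma>' = conn_coeff Dbar (adapted_frame A D c) q
         in \<Gamma>' (Inl j) (Inl i) (Inl h) = \<Gamma> j i h \<and>
            \<Gamma>' (Inl j) (Inl i) (Inr h) = (\<Sum>a\<in>UNIV. y a * K a i j h) \<and>
            \<Gamma>' (Inr j) (Inl i) (Inl h) = 1 / (2 * N\<^sup>2) * (g' i j * y h - kron i h * yl j) \<and>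
            \<Gamma>' (Inl j) (Inr i) (Inl h) = 1 / (2 * N\<^sup>2) * (g' i j * y h - kron j h * yl i) \<and>
            \<Gamma>' (Inr j) (Inl i) (Inr h) = \<Gamma> j i h \<and>
            \<Gamma>' (Inl j) (Inr i) (Inr h) = 0 \<and>
            \<Gamma>' (Inr j) (Inr i) (Inl h) = 0 \<and>
            \<Gamma>' (Inr j) (Inr i) (Inr h) = - 1 / (2 * N\<^sup>2) * (kron i h * yl j + kron j h * yl i)"
proof -
  interpret lifted_chart A c g D G Dbar
    using assms by unfold_locales (simp_all add: smooth_manifold_def)
  have "q \<in> fst (slit_chart A c)" using assms(7) by (simp add: fst_slit_chart)
  from lift_conn_coeff[OF this] show ?thesis by (simp only: Let_def simp_thms)
qed

end
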